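(* Let $\rho_{AB}$ be a density matrix on a finite-dimensional bipartite Hilbert space $\mathcal{H}_A\otimes\mathcal{H}_B$ with optimal eigendecomposition $\{\lambda_i,|\phi_i\rangle_{AB}\}_{i=1}^n$, let $\rho_i=|\phi_i\rangle\langle\phi_i|$, and let $$Q_{QC}(\rho_{AB})=\sum_{i=1}^n\lambda_iE(\rho_i)+\min_{U_f}\sum_{i,j=1}^n\lambda_i\lambda_jF(\rho_{Ai}\rho_{Aj}),$$ $$Q_{CQ}(\rho_{AB})=\sum_{i=1}^n\lambda_iE(\rho_i)+\min_{U_f}\sum_{i,j=1}^n\lambda_i\lambda_jF(\rho_{Bi}\rho_{Bj}),$$ with $E$, $F$ and $\min_{U_f}$ as described in the context. Then $Q_{QC}$ measures the quantum correlation subject to system $A$, i.e. $Q_{QC}(\rho_{AB})=0$ if and only if $\rho_{AB}$ is classically correlated subject to $A$; and $Q_{CQ}$ measures the quantum correlation subject to system $B$, i.e. $Q_{CQ}(\rho_{AB})=0$ if and only if $\rho_{AB}$ is classically correlated subject to $B$.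
   Context: All Hilbert spaces are finite-dimensional. Classically correlated subject to $A$: $\rho_{AB}=\sum_kp_k|\psi_k^A\rangle\langle\psi_k^A|\otimes\rho_k^B$ with $p_k>0$, $\sum_kp_k=1$, the vectors $|\psi_k^A\rangle$ belonging to some orthonormal basis of $\mathcal{H}_A$, and $\rho_k^B$ density matrices on $\mathcal{H}_B$. Classically correlated subject to $B$ is defined in the same way with the roles of $A$ and $B$ exchanged. Entanglement function: $E$ is an entanglement (inseparability) measure on pure states: $E\ge0$, $E(|\phi\rangle\langle\phi|)=E(|\phi\rangle)=0$ if and only if $|\phi\rangle$ is a product vector, and $E$ is invariant under local unitary transformations. Non-orthogonality function: $F(\rho_i\rho_j)$ is a function of a pair of density matrices of the same subsystem, invariant under local unitary operations, with $F(\rho_i\rho_j)=0$ if $\rho_i=\rho_j$ or $\rho_i$ is orthogonal to $\rho_j$ (i.e. $\rho_i\rho_j=0$), and $F(\rho_i\rho_j)>0$ otherwise. Optimal eigendecomposition: an eigendecomposition $\rho_{AB}=\sum_{i=1}^n\lambda_i|\phi_i\rangle\langle\phi_i|$, with $n$ the rank of $\rho_{AB}$, $\lambda_i>0$ and $|\phi_i\rangle$ orthonormal. If a nonzero eigenvalue $\lambda_s$ has multiplicity (degeneracy) $f_s$, its eigenvectors, taken as the columns of a matrix $\Phi$, may be replaced by the columns of $\Phi'=\Phi U_{f_s}$ for any $f_s\times f_s$ unitary $U_{f_s}$. The eigendecomposition is optimal if, among all these choices, it minimizes the average entanglement $\sum_s\frac1{f_s}\sum_{j=1}^{f_s}E(|\phi_j^s\rangle_{AB})$,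 where $s$ runs over the distinct nonzero eigenvalues and $|\phi_j^s\rangle$, $j=1,\dots,f_s$, are the chosen eigenvectors for $\lambda_s$. Optimal eigendecompositions need not be unique. $\rho_{Ai}=\mathrm{Tr}_B|\phi_i\rangle\langle\phi_i|$ and $\rho_{Bi}=\mathrm{Tr}_A|\phi_i\rangle\langle\phi_i|$. $\min_{U_f}$ denotes the minimum over the unitaries $U_f$ within the degenerate eigenspaces that yield optimal eigendecompositions (the minima are understood to be attained). *)

theory Defs
  imports "HOL-Analysis.Analysis"
begin

text \<open>
  The Hilbert space of a system with index type \<open>'n\<close> is \<open>complex ^ 'n\<close>; that of the bipartite system
  is \<open>complex ^ ('a \<times> 'b)\<close>, the pair \<open>(i, j)\<close> indexing the product basis vector
  \<open>e\<^sub>i \<otimes> e\<^sub>j\<close>.  The library's inner product on \<open>complex ^ 'n\<close> is the real one, hence the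
  sesquilinear product below.  It is conjugate-linear in the first argument.
\<close>

definition cinner :: "complex ^ 'n::finite \<Rightarrow> complex ^ 'n \<Rightarrow> complex" where
  "cinner u v = (\<Sum>i\<in>UNIV. cnj (u $ i) * v $ i)"

definition hconj :: "complex ^ 'n::finite ^ 'n \<Rightarrow> complex ^ 'n ^ 'n" where
  "hconj A = (\<chi> i j. cnj (A $ j $ i))"

definition unitary :: "complex ^ 'n::finite ^ 'n \<Rightarrow> bool" where
  "unitary U \<longleftrightarrow> hconj U ** U = mat 1 \<and> U ** hconj U = mat 1"

definition density_matrix :: "complex ^ 'n::finite ^ 'n \<Rightarrow> bool" where
  "density_matrix \<rho> \<longleftrightarrow>
     hconj \<rho> = \<rho> \<and> (\<forall>v. 0 \<le> Re (cinner v (\<rho> *v v))) \<and> trace \<rho> = 1"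

definition orthonormal_basis :: "(complex ^ 'n::finite) set \<Rightarrow> bool" where
  "orthonormal_basis B \<longleftrightarrow>
     (\<forall>u\<in>B. \<forall>v\<in>B. cinner u v = (if u = v then 1 else 0)) \<and> vec.span B = UNIV"

text \<open>\<open>proj \<phi>\<close> is the operator \<open>|\<phi>\<rangle>\<langle>\<phi>|\<close>.\<close>

definition proj :: "complex ^ 'n::finite \<Rightarrow> complex ^ 'n ^ 'n" where
  "proj \<phi> = (\<chi> i j. \<phi> $ i * cnj (\<phi> $ j))"

definition tensor_vec ::
  "complex ^ 'a::finite \<Rightarrow> complex ^ 'b::finite \<Rightarrow> complex ^ ('a \<times> 'b)" where
  "tensor_vec a b = (\<chi> p. a $ fst p * b $ snd p)"

definition tensor_mat ::
  "complex ^ 'a::finite ^ 'a \<Rightarrow> complex ^ 'b::finite ^ 'b \<Rightarrow> complex ^ ('a \<times> 'b) ^ ('a \<times> 'b)" where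
  "tensor_mat M N = (\<chi> p q. M $ fst p $ fst q * N $ snd p $ snd q)"

definition product_vector :: "complex ^ ('a::finite \<times> 'b::finite) \<Rightarrow> bool" where
  "product_vector \<phi> \<longleftrightarrow> (\<exists>a b. \<phi> = tensor_vec a b)"

text \<open>\<open>ptrace_A\<close> traces out the first factor and \<open>ptrace_B\<close> the second.\<close>

definition ptrace_A ::
  "complex ^ ('a::finite \<times> 'b::finite) ^ ('a \<times> 'b) \<Rightarrow> complex ^ 'b ^ 'b" where
  "ptrace_A M = (\<chi> i j. \<Sum>k\<in>UNIV. M $ (k, i) $ (k, j))"

definition ptrace_B ::
  "complex ^ ('a::finite \<times> 'b::finite) ^ ('a \<times> 'b) \<Rightarrow> complex ^ 'a ^ 'a" where
  "ptrace_B M = (\<chi> i j. \<Sum>k\<in>UNIV. M $ (i, k) $ (j, k))"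

definition classically_correlated_A ::
  "complex ^ ('a::finite \<times> 'b::finite) ^ ('a \<times> 'b) \<Rightarrow> bool" where
  "classically_correlated_A \<rho> \<longleftrightarrow>
     (\<exists>(m::nat) (p :: nat \<Rightarrow> real) (\<psi> :: nat \<Rightarrow> complex ^ 'a) (\<sigma> :: nat \<Rightarrow> complex ^ 'b ^ 'b) B.
        (\<forall>k<m. 0 < p k) \<and> (\<Sum>k<m. p k) = 1 \<and>
        orthonormal_basis B \<and> (\<forall>k<m. \<psi> k \<in> B) \<and> (\<forall>k<m. density_matrix (\<sigma> k)) \<and>
        \<rho> = (\<Sum>k<m. p k *\<^sub>R tensor_mat (proj (\<psi> k)) (\<sigma> k)))"

definition classically_correlated_B ::
  "complex ^ ('a::finite \<times> 'b::finite) ^ ('a \<times> 'b) \<Rightarrow> bool" where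
  "classically_correlated_B \<rho> \<longleftrightarrow>
     (\<exists>(m::nat) (p :: nat \<Rightarrow> real) (\<psi> :: nat \<Rightarrow> complex ^ 'b) (\<sigma> :: nat \<Rightarrow> complex ^ 'a ^ 'a) B.
        (\<forall>k<m. 0 < p k) \<and> (\<Sum>k<m. p k) = 1 \<and>
        orthonormal_basis B \<and> (\<forall>k<m. \<psi> k \<in> B) \<and> (\<forall>k<m. density_matrix (\<sigma> k)) \<and>
        \<rho> = (\<Sum>k<m. p k *\<^sub>R tensor_mat (\<sigma> k) (proj (\<psi> k))))"

text \<open>
  An entanglement measure is a function of the operator \<open>|\<phi>\<rangle>\<langle>\<phi>|\<close>; its values off
  the pure states are unconstrained and never used.
\<close>

definition entanglement_measure ::
  "(complex ^ ('a::finite \<times> 'b::finite) ^ ('a \<times> 'b) \<Rightarrow> real) \<Rightarrow> bool" where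
  "entanglement_measure E \<longleftrightarrow>
     (\<forall>\<phi>. norm \<phi> = 1 \<longrightarrow> 0 \<le> E (proj \<phi>) \<and> (E (proj \<phi>) = 0 \<longleftrightarrow> product_vector \<phi>)) \<and>
     (\<forall>\<phi> U V. norm \<phi> = 1 \<longrightarrow> unitary U \<longrightarrow> unitary V \<longrightarrow>
        E (proj (tensor_mat U V *v \<phi>)) = E (proj \<phi>))"

definition nonorthogonality_measure ::
  "(complex ^ 'n::finite ^ 'n \<Rightarrow> complex ^ 'n ^ 'n \<Rightarrow> real) \<Rightarrow> bool" where
  "nonorthogonality_measure F \<longleftrightarrow>
     (\<forall>\<rho> \<sigma>. density_matrix \<rho> \<longrightarrow> density_matrix \<sigma> \<longrightarrow>
        (if \<rho> = \<sigma> \<or> \<rho> ** \<sigma> = 0 then F \<rho> \<sigma> = 0 else F \<rho> \<sigma> > 0)) \<and>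
     (\<forall>\<rho> \<sigma> U. density_matrix \<rho> \<longrightarrow> density_matrix \<sigma> \<longrightarrow> unitary U \<longrightarrow>
        F (U ** \<rho> ** hconj U) (U ** \<sigma> ** hconj U) = F \<rho> \<sigma>)"

definition eigendecomposition ::
  "complex ^ 'n::finite ^ 'n \<Rightarrow> nat \<Rightarrow> (nat \<Rightarrow> real) \<Rightarrow> (nat \<Rightarrow> complex ^ 'n) \<Rightarrow> bool" where
  "eigendecomposition \<rho> n l \<phi> \<longleftrightarrow>
     n = rank \<rho> \<and> (\<forall>i<n. 0 < l i) \<and>
     (\<forall>i<n. \<forall>j<n. cinner (\<phi> i) (\<phi> j) = (if i = j then 1 else 0)) \<and>
     \<rho> = (\<Sum>i<n. l i *\<^sub>R proj (\<phi> i))"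

definition eigen_block :: "nat \<Rightarrow> (nat \<Rightarrow> real) \<Rightarrow> real \<Rightarrow> nat set" where
  "eigen_block n l s = {i. i < n \<and> l i = s}"

text \<open>
  A family of unitaries, one on each degenerate eigenspace, is encoded as a single array \<open>U\<close> whose
  restriction to each block \<open>eigen_block n l s \<times> eigen_block n l s\<close> is unitary.  Entries outside these
  blocks are neither constrained nor used.
\<close>

definition block_unitary :: "nat \<Rightarrow> (nat \<Rightarrow> real) \<Rightarrow> (nat \<Rightarrow> nat \<Rightarrow> complex) \<Rightarrow> bool" where
  "block_unitary n l U \<longleftrightarrow>
     (\<forall>s\<in>l ` {..<n}. \<forall>i\<in>eigen_block n l s. \<forall>j\<in>eigen_block n l s.
        (\<Sum>k\<in>eigen_block n l s. cnj (U k i) * U k j) = (if i = j then 1 else 0) \<and>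
        (\<Sum>k\<in>eigen_block n l s. U i k * cnj (U j k)) = (if i = j then 1 else 0))"

text \<open>The columns of \<open>\<Phi> U\<close>, eigenspace by eigenspace.\<close>

definition rotate_eigenvectors ::
  "nat \<Rightarrow> (nat \<Rightarrow> real) \<Rightarrow> (nat \<Rightarrow> nat \<Rightarrow> complex) \<Rightarrow> (nat \<Rightarrow> complex ^ 'n::finite) \<Rightarrow> nat \<Rightarrow> complex ^ 'n"
  where
  "rotate_eigenvectors n l U \<phi> i = (\<Sum>j\<in>eigen_block n l (l i). U j i *s \<phi> j)"

definition average_entanglement ::
  "(complex ^ 'n::finite ^ 'n \<Rightarrow> real) \<Rightarrow> nat \<Rightarrow> (nat \<Rightarrow> real) \<Rightarrow> (nat \<Rightarrow> complex ^ 'n) \<Rightarrow> real" where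
  "average_entanglement E n l \<phi> =
     (\<Sum>s\<in>l ` {..<n}. 1 / real (card (eigen_block n l s)) *
        (\<Sum>j\<in>eigen_block n l s. E (proj (\<phi> j))))"

definition optimal_eigendecomposition ::
  "(complex ^ 'n::finite ^ 'n \<Rightarrow> real) \<Rightarrow> complex ^ 'n ^ 'n \<Rightarrow>
     nat \<Rightarrow> (nat \<Rightarrow> real) \<Rightarrow> (nat \<Rightarrow> complex ^ 'n) \<Rightarrow> bool" where
  "optimal_eigendecomposition E \<rho> n l \<phi> \<longleftrightarrow>
     eigendecomposition \<rho> n l \<phi> \<and>
     (\<forall>U. block_unitary n l U \<longrightarrow>
        average_entanglement E n l \<phi> \<le> average_entanglement E n l (rotate_eigenvectors n l U \<phi>))"

definition optimal_unitaries ::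
  "(complex ^ 'n::finite ^ 'n \<Rightarrow> real) \<Rightarrow> complex ^ 'n ^ 'n \<Rightarrow>
     nat \<Rightarrow> (nat \<Rightarrow> real) \<Rightarrow> (nat \<Rightarrow> complex ^ 'n) \<Rightarrow> (nat \<Rightarrow> nat \<Rightarrow> complex) set" where
  "optimal_unitaries E \<rho> n l \<phi> =
     {U. block_unitary n l U \<and>
         optimal_eigendecomposition E \<rho> n l (rotate_eigenvectors n l U \<phi>)}"

definition nonorthogonality_A ::
  "(complex ^ 'a::finite ^ 'a \<Rightarrow> complex ^ 'a ^ 'a \<Rightarrow> real) \<Rightarrow>
     nat \<Rightarrow> (nat \<Rightarrow> real) \<Rightarrow> (nat \<Rightarrow> complex ^ ('a \<times> 'b::finite)) \<Rightarrow> real" where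
  "nonorthogonality_A F n l \<phi> =
     (\<Sum>i<n. \<Sum>j<n. l i * l j * F (ptrace_B (proj (\<phi> i))) (ptrace_B (proj (\<phi> j))))"

definition nonorthogonality_B ::
  "(complex ^ 'b::finite ^ 'b \<Rightarrow> complex ^ 'b ^ 'b \<Rightarrow> real) \<Rightarrow>
     nat \<Rightarrow> (nat \<Rightarrow> real) \<Rightarrow> (nat \<Rightarrow> complex ^ ('a::finite \<times> 'b)) \<Rightarrow> real" where
  "nonorthogonality_B F n l \<phi> =
     (\<Sum>i<n. \<Sum>j<n. l i * l j * F (ptrace_A (proj (\<phi> i))) (ptrace_A (proj (\<phi> j))))"

definition attains_min :: "('u \<Rightarrow> real) \<Rightarrow> 'u set \<Rightarrow> bool" where
  "attains_min g S \<longleftrightarrow> (\<exists>u\<in>S. \<forall>v\<in>S. g u \<le> g v)"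

text \<open>
  The infima below are the minima over the optimal unitaries whenever these are attained; attainment
  is not built into the definitions and has to be assumed via \<^const>\<open>attains_min\<close>.
\<close>

definition Q_QC ::
  "(complex ^ ('a::finite \<times> 'b::finite) ^ ('a \<times> 'b) \<Rightarrow> real) \<Rightarrow>
     (complex ^ 'a ^ 'a \<Rightarrow> complex ^ 'a ^ 'a \<Rightarrow> real) \<Rightarrow>
     complex ^ ('a \<times> 'b) ^ ('a \<times> 'b) \<Rightarrow>
     nat \<Rightarrow> (nat \<Rightarrow> real) \<Rightarrow> (nat \<Rightarrow> complex ^ ('a \<times> 'b)) \<Rightarrow> real" where
  "Q_QC E F \<rho> n l \<phi> =
     (\<Sum>i<n. l i * E (proj (\<phi> i))) +
     (INF U\<in>optimal_unitaries E \<rho> n l \<phi>. nonorthogonality_A F n l (rotate_eigenvectors n l U \<phi>))"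

definition Q_CQ ::
  "(complex ^ ('a::finite \<times> 'b::finite) ^ ('a \<times> 'b) \<Rightarrow> real) \<Rightarrow>
     (complex ^ 'b ^ 'b \<Rightarrow> complex ^ 'b ^ 'b \<Rightarrow> real) \<Rightarrow>
     complex ^ ('a \<times> 'b) ^ ('a \<times> 'b) \<Rightarrow>
     nat \<Rightarrow> (nat \<Rightarrow> real) \<Rightarrow> (nat \<Rightarrow> complex ^ ('a \<times> 'b)) \<Rightarrow> real" where
  "Q_CQ E F \<rho> n l \<phi> =
     (\<Sum>i<n. l i * E (proj (\<phi> i))) +
     (INF U\<in>optimal_unitaries E \<rho> n l \<phi>. nonorthogonality_B F n l (rotate_eigenvectors n l U \<phi>))"

end

theory Submission
  imports Defs
begin

text \<open>
  All terms of the measures are nonnegative, so a measure vanishes exactly when some rotation within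
  the eigenspaces makes every eigenvector a product vector, with reduced states that are pairwise
  equal or orthogonal.  Such reduced states are projections onto members of one orthonormal basis,
  which exhibits \<open>\<rho>\<close> as classically correlated.  Conversely, if \<open>\<rho>\<close> is classically correlated along
  an orthonormal basis \<open>B\<close>, the local projections onto the members of \<open>B\<close> commute with \<open>\<rho>\<close>, hence
  split each eigenspace, which therefore has an orthonormal basis of product vectors with a factor
  in \<open>B\<close>.  This choice has average entanglement zero, so every optimal choice does.
\<close>

subsection \<open>Sesquilinear algebra\<close>

text \<open>The two summands of a measure look at different families: the entanglement sum is
  evaluated at the given \<open>\<phi>\<close>, the nonorthogonality sum at rotations of it.
  Vanishing has to be carried from one family to the other, and the average entanglement is the
  carrier. Its weights 1/f_s differ from the eigenvalues in the entanglement sum, but both kinds of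
  weight are positive and the terms nonnegative, so either sum is zero exactly when the family
  consists of product vectors. All optimal families share one average, since a rotation can be
  undone. Degeneracy is the obstacle. Even an eigenbasis of product vectors may have reduced states
  that are neither equal nor orthogonal: for the maximally mixed state of two qubits, take |0>|0>,
  |1>|0>, |+>|1>, |->|1> and reduce to the first qubit. The local projections therefore act on whole
  eigenspaces, and the basis they produce is translated back into a unitary array indexed like
  \<open>\<phi>\<close>.\<close>

lemma cinner_add_right: "cinner u (v + w) = cinner u v + cinner u w"
  by (simp add: cinner_def distrib_left sum.distrib)

lemma cinner_diff_right: "cinner u (v - w) = cinner u v - cinner u w"
  by (simp add: cinner_def right_diff_distrib sum_subtractf)

lemma cinner_scale_right: "cinner u (c *s v) = c * cinner u v"
  by (simp add: cinner_def sum_distrib_left mult_ac)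

lemma cinner_zero_right [simp]: "cinner u 0 = 0"
  by (simp add: cinner_def)

lemma cinner_sum_right: "cinner u (\<Sum>i\<in>S. f i) = (\<Sum>i\<in>S. cinner u (f i))"
  by (induction S rule: infinite_finite_induct) (simp_all add: cinner_add_right)

lemma cinner_commute: "cinner v u = cnj (cinner u v)"
  by (simp add: cinner_def mult.commute)

lemma cinner_scale_left: "cinner (c *s u) v = cnj c * cinner u v"
  by (simp add: cinner_def sum_distrib_left mult_ac)

lemma cinner_sum_left: "cinner (\<Sum>i\<in>S. f i) u = (\<Sum>i\<in>S. cinner (f i) u)"
  by (subst cinner_commute) (simp add: cinner_sum_right cinner_commute[of u])

lemma cinner_self: "cinner v v = of_real ((norm v)\<^sup>2)"
  by (simp add: cinner_def norm_vec_def L2_set_def sum_nonneg mult.commute[of "cnj _"]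
      complex_norm_square del: of_real_power)

lemma cinner_self_eq_1: "cinner v v = 1 \<longleftrightarrow> norm v = 1"
proof -
  have "cinner v v = 1 \<longleftrightarrow> (norm v)\<^sup>2 = 1"
    by (metis cinner_self of_real_1 of_real_eq_iff)
  then show ?thesis
    by (simp add: power2_eq_1_iff) (metis norm_ge_zero not_one_le_zero neg_0_le_iff_le)
qed

lemma exists_unit_multiple:
  fixes v :: "complex ^ 'n::finite"
  assumes "v \<noteq> 0"
  obtains c where "norm (c *s v) = 1"
proof
  show "norm (of_real (1 / norm v) *s v) = 1"
    unfolding cinner_self_eq_1[symmetric] cinner_scale_left cinner_scale_right
    using assms by (simp add: cinner_self power2_eq_square)
qed

lemma cinner_hconj: "cinner (hconj M *v u) v = cinner u (M *v v)"
  by (simp add: cinner_def hconj_def matrix_vector_mult_def sum_distrib_left sum_distrib_right mult_ac)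
     (rule sum.swap)

lemma proj_matrix_vector: "proj \<phi> *v v = cinner \<phi> v *s \<phi>"
  by (simp add: vec_eq_iff proj_def cinner_def matrix_vector_mult_def sum_distrib_left sum_distrib_right mult_ac)

lemma matrix_vector_sum: "(\<Sum>i\<in>S. M i) *v v = (\<Sum>i\<in>S. M i *v v)"
  for M :: "'i \<Rightarrow> 'k::semiring_1 ^ 'n::finite ^ 'm::finite"
  by (induction S rule: infinite_finite_induct)
     (simp_all add: matrix_vector_mult_add_rdistrib)

lemma scaleR_matrix_vector: "(c *\<^sub>R M) *v v = of_real c *s (M *v v)"
  for M :: "complex ^ 'n::finite ^ 'm::finite"
  by (simp add: vec_eq_iff matrix_vector_mult_def sum_distrib_left scaleR_conv_of_real[of _ "_::complex"] mult_ac)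

lemma trace_proj: "trace (proj \<phi>) = cinner \<phi> \<phi>"
  by (simp add: trace_def proj_def cinner_def mult.commute)

lemma trace_sum: "trace (\<Sum>i\<in>S. M i) = (\<Sum>i\<in>S. trace (M i))"
  for M :: "'i \<Rightarrow> complex ^ 'n::finite ^ 'n"
  by (induction S rule: infinite_finite_induct) (simp_all add: trace_add trace_0[unfolded mat_0])

lemma trace_scaleR: "trace (c *\<^sub>R M) = of_real c * trace M"
  for M :: "complex ^ 'n::finite ^ 'n"
  by (simp add: trace_def sum_distrib_left scaleR_conv_of_real[of _ "_::complex"])

lemma hconj_proj: "hconj (proj \<phi>) = proj \<phi>"
  by (simp add: vec_eq_iff hconj_def proj_def mult.commute)

lemma density_matrix_proj:
  assumes "norm \<phi> = 1"
  shows "density_matrix (proj \<phi>)"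
proof -
  have "0 \<le> Re (cinner v (proj \<phi> *v v))" for v
  proof -
    have "cinner v (proj \<phi> *v v) = cinner \<phi> v * cnj (cinner \<phi> v)"
      by (simp add: proj_matrix_vector cinner_scale_right cinner_commute[of v])
    then show ?thesis
      by (simp add: complex_mult_cnj)
  qed
  with assms show ?thesis
    by (simp add: density_matrix_def hconj_proj trace_proj cinner_self)
qed

text \<open>Entrywise form of |a><a| |b><b| = <a,b> |a><b|. The outer product is nonzero for nonzero
  vectors, so the scalar alone decides whether the product vanishes.\<close>

lemma proj_mult_proj: "(proj a ** proj b) $ i $ j = cinner a b * (a $ i * cnj (b $ j))"
  by (simp add: matrix_matrix_mult_def proj_def cinner_def sum_distrib_left sum_distrib_right mult_ac)

lemma proj_mult_proj_eq_0:
  assumes "a \<noteq> 0" "b \<noteq> 0"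
  shows "proj a ** proj b = 0 \<longleftrightarrow> cinner a b = 0"
proof -
  obtain i j where "a $ i \<noteq> 0" "b $ j \<noteq> 0"
    using assms by (auto simp: vec_eq_iff)
  then show ?thesis
    by (auto simp: vec_eq_iff proj_mult_proj)
qed

subsection \<open>Tensor products and partial traces\<close>

lemma sum_UNIV_prod: "(\<Sum>p\<in>UNIV. f p) = (\<Sum>i\<in>UNIV. \<Sum>j\<in>UNIV. f (i, j))"
  for f :: "'a::finite \<times> 'b::finite \<Rightarrow> 'c::comm_monoid_add"
  by (simp add: sum.cartesian_product)

lemma cinner_tensor: "cinner (tensor_vec a b) (tensor_vec c d) = cinner a c * cinner b d"
  by (simp add: cinner_def tensor_vec_def sum_UNIV_prod sum_product mult_ac)

lemma tensor_mat_mult: "tensor_mat M N ** tensor_mat M' N' = tensor_mat (M ** M') (N ** N')"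
  by (simp add: vec_eq_iff matrix_matrix_mult_def tensor_mat_def sum_UNIV_prod sum_product mult_ac)

lemma tensor_mat_vec: "tensor_mat M N *v tensor_vec a b = tensor_vec (M *v a) (N *v b)"
  by (simp add: vec_eq_iff matrix_vector_mult_def tensor_mat_def tensor_vec_def sum_UNIV_prod
      sum_product mult_ac)

lemma hconj_tensor_mat: "hconj (tensor_mat M N) = tensor_mat (hconj M) (hconj N)"
  by (simp add: vec_eq_iff hconj_def tensor_mat_def)

lemma hconj_mat_1: "hconj (mat 1) = mat 1"
  by (simp add: vec_eq_iff hconj_def mat_def)

lemma tensor_mat_mat_1: "tensor_mat (mat 1) (mat 1) = mat 1"
  by (simp add: vec_eq_iff tensor_mat_def mat_def prod_eq_iff)

lemma tensor_mat_sum_left: "tensor_mat (\<Sum>i\<in>S. M i) N = (\<Sum>i\<in>S. tensor_mat (M i) N)"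
  by (simp add: vec_eq_iff tensor_mat_def sum_distrib_right)

lemma tensor_mat_sum_right: "tensor_mat M (\<Sum>i\<in>S. N i) = (\<Sum>i\<in>S. tensor_mat M (N i))"
  by (simp add: vec_eq_iff tensor_mat_def sum_distrib_left)

lemma tensor_vec_scale_left: "tensor_vec (c *s a) b = c *s tensor_vec a b"
  by (simp add: vec_eq_iff tensor_vec_def)

lemma tensor_vec_scale_right: "tensor_vec a (c *s b) = c *s tensor_vec a b"
  by (simp add: vec_eq_iff tensor_vec_def)

lemma proj_tensor: "proj (tensor_vec a b) = tensor_mat (proj a) (proj b)"
  by (simp add: vec_eq_iff proj_def tensor_mat_def tensor_vec_def mult_ac)

lemma ptrace_B_proj_tensor:
  assumes "norm b = 1"
  shows "ptrace_B (proj (tensor_vec a b)) = proj a"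
proof -
  have "(\<Sum>k\<in>UNIV. b $ k * cnj (b $ k)) = 1"
    using assms cinner_self_eq_1[of b] by (simp add: cinner_def mult.commute)
  then have "(\<Sum>k\<in>UNIV. x * (b $ k * cnj (b $ k))) = x" for x
    by (simp flip: sum_distrib_left)
  then show ?thesis
    by (simp add: proj_tensor vec_eq_iff ptrace_B_def tensor_mat_def) (simp add: proj_def)
qed

lemma ptrace_A_proj_tensor:
  assumes "norm a = 1"
  shows "ptrace_A (proj (tensor_vec a b)) = proj b"
proof -
  have "(\<Sum>k\<in>UNIV. a $ k * cnj (a $ k)) = 1"
    using assms cinner_self_eq_1[of a] by (simp add: cinner_def mult.commute)
  then have "(\<Sum>k\<in>UNIV. (a $ k * cnj (a $ k)) * x) = x" for x
    by (simp flip: sum_distrib_right)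
  then show ?thesis
    by (simp add: proj_tensor vec_eq_iff ptrace_A_def tensor_mat_def) (simp add: proj_def)
qed

text \<open>Each \<open>proj (f k)\<close> contributes a squared modulus to the quadratic form,
  which leaves the trace as the only condition. Reduced states of a vector have this shape: tracing
  out a factor sums \<open>proj\<close> over the slices of the vector at fixed index of that
  factor.\<close>

lemma density_matrix_gram:
  fixes f :: "'k::finite \<Rightarrow> complex ^ 'n::finite"
  assumes "trace (\<Sum>k\<in>UNIV. proj (f k)) = 1"
  shows "density_matrix (\<Sum>k\<in>UNIV. proj (f k))"
proof -
  have "hconj (\<Sum>k\<in>UNIV. proj (f k)) = (\<Sum>k\<in>UNIV. proj (f k))"
    by (simp add: vec_eq_iff hconj_def proj_def mult.commute)
  moreover have "0 \<le> Re (cinner v ((\<Sum>k\<in>UNIV. proj (f k)) *v v))" for v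
  proof -
    have "cinner v ((\<Sum>k\<in>UNIV. proj (f k)) *v v) = (\<Sum>k\<in>UNIV. cinner (f k) v * cnj (cinner (f k) v))"
      by (simp add: matrix_vector_sum proj_matrix_vector cinner_scale_right cinner_sum_right
          cinner_commute[of v])
    then show ?thesis
      by (simp add: complex_mult_cnj sum_nonneg)
  qed
  ultimately show ?thesis
    using assms by (simp add: density_matrix_def)
qed

lemma density_matrix_ptrace_B:
  assumes "norm \<phi> = 1"
  shows "density_matrix (ptrace_B (proj \<phi>))"
proof -
  have eq: "ptrace_B (proj \<phi>) = (\<Sum>k\<in>UNIV. proj (\<chi> i. \<phi> $ (i, k)))"
    by (simp add: vec_eq_iff ptrace_B_def proj_def)
  have "trace (ptrace_B (proj \<phi>)) = cinner \<phi> \<phi>"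
    by (simp add: trace_def ptrace_B_def proj_def cinner_def sum_UNIV_prod mult.commute)
  then show ?thesis
    unfolding eq using assms cinner_self_eq_1 by (metis density_matrix_gram)
qed

lemma density_matrix_ptrace_A:
  assumes "norm \<phi> = 1"
  shows "density_matrix (ptrace_A (proj \<phi>))"
proof -
  have eq: "ptrace_A (proj \<phi>) = (\<Sum>k\<in>UNIV. proj (\<chi> i. \<phi> $ (k, i)))"
    by (simp add: vec_eq_iff ptrace_A_def proj_def)
  have "trace (ptrace_A (proj \<phi>)) = (\<Sum>j\<in>UNIV. \<Sum>i\<in>UNIV. \<phi> $ (i, j) * cnj (\<phi> $ (i, j)))"
    by (simp add: trace_def ptrace_A_def proj_def)
  also have "\<dots> = (\<Sum>i\<in>UNIV. \<Sum>j\<in>UNIV. \<phi> $ (i, j) * cnj (\<phi> $ (i, j)))"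
    by (rule sum.swap)
  also have "\<dots> = cinner \<phi> \<phi>"
    by (simp add: cinner_def sum_UNIV_prod mult.commute)
  finally show ?thesis
    unfolding eq using assms cinner_self_eq_1 by (metis density_matrix_gram)
qed

text \<open>The squared norms of the factors multiply to 1. Scaling the left factor to unit length
  by \<open>c\<close> and the right one by \<open>inverse c\<close> leaves the tensor unchanged,
  which forces unit length on the right as well.\<close>

lemma unit_product_vectorE:
  assumes "product_vector \<phi>" "norm \<phi> = 1"
  obtains a b where "\<phi> = tensor_vec a b" "norm a = 1" "norm b = 1"
proof -
  obtain a b where \<phi>: "\<phi> = tensor_vec a b"
    using assms(1) by (auto simp: product_vector_def)
  have ab: "cinner a a * cinner b b = 1"
    using assms(2) cinner_self_eq_1[of \<phi>] by (simp add: \<phi> cinner_tensor)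
  then have "a \<noteq> 0"
    by auto
  then obtain c where c: "norm (c *s a) = 1"
    by (rule exists_unit_multiple)
  then have "c \<noteq> 0"
    by auto
  then have *: "\<phi> = tensor_vec (c *s a) (inverse c *s b)"
    by (simp add: \<phi> vec_eq_iff tensor_vec_def)
  then have "cinner (c *s a) (c *s a) * cinner (inverse c *s b) (inverse c *s b) = 1"
    using assms(2) by (simp add: cinner_self_eq_1 flip: cinner_tensor)
  then have "norm (inverse c *s b) = 1"
    using c cinner_self_eq_1 by (metis mult_1)
  with * c that show ?thesis
    by blast
qed

subsection \<open>Orthonormal sets\<close>

definition orthonormal :: "(complex ^ 'n::finite) set \<Rightarrow> bool" where
  "orthonormal S \<longleftrightarrow> (\<forall>u\<in>S. \<forall>v\<in>S. cinner u v = (if u = v then 1 else 0))"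

lemma orthonormal_coefficient:
  assumes "orthonormal T" "finite T" "t \<in> T"
  shows "cinner t (\<Sum>u\<in>T. c u *s u) = c t"
proof -
  have "cinner t (\<Sum>u\<in>T. c u *s u) = (\<Sum>u\<in>T. if u = t then c u else 0)"
    unfolding cinner_sum_right cinner_scale_right
    using assms by (intro sum.cong) (auto simp: orthonormal_def)
  then show ?thesis
    using assms by simp
qed

lemma orthonormal_independent:
  assumes "orthonormal S"
  shows "vec.independent S"
  unfolding vec.independent_explicit_finite_subsets
proof (intro allI impI ballI)
  fix T u v assume "T \<subseteq> S" "finite T" "(\<Sum>v\<in>T. u v *s v) = 0" "v \<in> T"
  moreover from this assms have "orthonormal T"
    unfolding orthonormal_def by blast
  ultimately show "u v = 0"
    using orthonormal_coefficient[of T v u] by simp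
qed

lemma orthonormal_expansion_span:
  assumes "orthonormal T" "finite T" "v \<in> vec.span T"
  shows "v = (\<Sum>t\<in>T. cinner t v *s t)"
proof -
  obtain c where c: "v = (\<Sum>t\<in>T. c t *s t)"
    using assms by (auto simp: vec.span_finite)
  then show ?thesis
    using assms orthonormal_coefficient[of T _ c] by simp
qed

text \<open>Orthonormal sets are independent, so the dimension bounds their cardinality and a
  largest one exists; a unit vector of \<open>W\<close> orthogonal to all of it could be added.
  \<open>W\<close> is an arbitrary set because one use takes the whole space and another the
  eigenvectors of a prescribed form, which are not closed under addition in general.\<close>

lemma maximal_orthonormal_extension:
  fixes S :: "(complex ^ 'n::finite) set"
  assumes "orthonormal S" "S \<subseteq> W"
  obtains T where "S \<subseteq> T" "T \<subseteq> W" "orthonormal T" "finite T"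
    "\<And>u. u \<in> W \<Longrightarrow> norm u = 1 \<Longrightarrow> \<exists>t\<in>T. cinner t u \<noteq> 0"
proof -
  define P where "P T \<longleftrightarrow> S \<subseteq> T \<and> T \<subseteq> W \<and> orthonormal T" for T
  have fin: "finite T" "card T < Suc (vec.dim (UNIV :: (complex ^ 'n) set))" if "orthonormal T"
    for T :: "(complex ^ 'n) set"
    using vec.independent_bound_general[of T] vec.independent_card_le_dim[of T UNIV] that
    by (auto simp: orthonormal_independent)
  have "P S"
    using assms by (simp add: P_def)
  moreover have "\<forall>T. P T \<longrightarrow> card T < Suc (vec.dim (UNIV :: (complex ^ 'n) set))"
    using fin(2) unfolding P_def by blast
  ultimately obtain T where T: "P T" and max: "\<And>T'. P T' \<Longrightarrow> card T' \<le> card T"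
    by (metis ex_has_greatest_nat)
  have "\<exists>t\<in>T. cinner t u \<noteq> 0" if u: "u \<in> W" "norm u = 1" for u
  proof (rule ccontr)
    assume "\<not> ?thesis"
    then have orth: "cinner t u = 0" "cinner u t = 0" if "t \<in> T" for t
      using that by (auto simp: cinner_commute[of u t])
    have uu: "cinner u u = 1"
      using u by (simp add: cinner_self_eq_1)
    then have "u \<notin> T"
      using orth by force
    moreover have "orthonormal (insert u T)"
      using T orth uu by (auto simp: orthonormal_def P_def)
    then have "P (insert u T)"
      using T u by (auto simp: P_def)
    ultimately show False
      using max[of "insert u T"] fin T by (auto simp: P_def)
  qed
  then show ?thesis
    using T fin that by (auto simp: P_def)
qed

lemma cinner_residual:
  assumes "orthonormal T" "finite T" "t \<in> T"
  shows "cinner t (v - (\<Sum>u\<in>T. cinner u v *s u)) = 0"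
  using orthonormal_coefficient[OF assms] by (simp add: cinner_diff_right)

text \<open>Subtracting from a vector its expansion in the maximal set \<open>T\<close> leaves a
  residual orthogonal to \<open>T\<close>. A nonzero residual, once normalised, would contradict
  maximality, so \<open>T\<close> spans.\<close>

lemma extend_to_orthonormal_basis:
  assumes "orthonormal S"
  obtains B where "S \<subseteq> B" "orthonormal_basis B"
proof -
  obtain T where T: "S \<subseteq> T" "orthonormal T" "finite T"
    and max: "\<And>u. norm u = 1 \<Longrightarrow> \<exists>t\<in>T. cinner t u \<noteq> 0"
    using maximal_orthonormal_extension[OF assms, of UNIV] by auto
  have "v \<in> vec.span T" for v
  proof -
    define w where "w = v - (\<Sum>u\<in>T. cinner u v *s u)"
    have "w = 0"
    proof (rule ccontr)
      assume "w \<noteq> 0"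
      then obtain c where "norm (c *s w) = 1"
        by (rule exists_unit_multiple)
      then show False
        using max[of "c *s w"] cinner_residual[OF T(2,3)]
        unfolding cinner_scale_right w_def by simp
    qed
    moreover have "(\<Sum>u\<in>T. cinner u v *s u) \<in> vec.span T"
      by (intro vec.span_sum vec.span_scale vec.span_base)
    ultimately show ?thesis
      by (simp add: w_def)
  qed
  then have "orthonormal_basis T"
    using T by (auto simp: orthonormal_basis_def orthonormal_def)
  with T that show ?thesis
    by blast
qed

lemma orthonormal_basis_finite:
  assumes "orthonormal_basis B"
  shows "finite B" "orthonormal B"
  using assms orthonormal_independent vec.finiteI_independent
  by (auto simp: orthonormal_basis_def orthonormal_def)

lemma sum_proj_orthonormal_basis:
  assumes "orthonormal_basis B"
  shows "(\<Sum>b\<in>B. proj b) = mat 1"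
proof -
  have "(\<Sum>b\<in>B. proj b) *v v = mat 1 *v v" for v
    using orthonormal_expansion_span[of B v] assms orthonormal_basis_finite[OF assms]
    by (simp add: matrix_vector_sum proj_matrix_vector orthonormal_basis_def)
  then show ?thesis
    by (simp add: matrix_eq)
qed

lemma cinner_expansion:
  assumes "v = (\<Sum>i\<in>I. cinner (a i) v *s a i)"
  shows "cinner u v = (\<Sum>i\<in>I. cinner u (a i) * cinner (a i) v)"
  by (subst assms) (simp add: cinner_sum_right cinner_scale_right mult.commute)

text \<open>Parseval counted twice: the matrix of the squared moduli of
  \<open>cinner (a i) (b j)\<close> has all row sums and all column sums equal to 1, so its total is
  both \<open>card I\<close> and \<open>card J\<close>. This matches an abstractly obtained basis of
  an eigenspace with the index block of the given one.\<close>

lemma card_eq_of_mutual_expansion: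
  assumes "\<And>i. i \<in> I \<Longrightarrow> norm (a i) = 1" "\<And>j. j \<in> J \<Longrightarrow> norm (b j) = 1"
    and a: "\<And>i. i \<in> I \<Longrightarrow> a i = (\<Sum>j\<in>J. cinner (b j) (a i) *s b j)"
    and b: "\<And>j. j \<in> J \<Longrightarrow> b j = (\<Sum>i\<in>I. cinner (a i) (b j) *s a i)"
  shows "card I = card J"
proof -
  have I: "(\<Sum>j\<in>J. cinner (a i) (b j) * cinner (b j) (a i)) = 1" if "i \<in> I" for i
    using cinner_expansion[where v = "a i" and a = b and I = J and u = "a i", OF a[OF that]] assms(1)[OF that]
    by (simp only: cinner_self) simp
  have J: "(\<Sum>i\<in>I. cinner (a i) (b j) * cinner (b j) (a i)) = 1" if "j \<in> J" for j
    using cinner_expansion[where v = "b j" and a = a and I = I and u = "b j", OF b[OF that]] assms(2)[OF that]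
    by (simp only: cinner_self mult.commute) simp
  have "of_nat (card I) = (\<Sum>i\<in>I. \<Sum>j\<in>J. cinner (a i) (b j) * cinner (b j) (a i))"
    by (simp add: I)
  also have "\<dots> = (\<Sum>j\<in>J. \<Sum>i\<in>I. cinner (a i) (b j) * cinner (b j) (a i))"
    by (rule sum.swap)
  also have "\<dots> = of_nat (card J)"
    by (simp add: J)
  finally show ?thesis
    by (simp only: of_nat_eq_iff)
qed

subsection \<open>Eigendecompositions\<close>

lemma finite_eigen_block [simp]: "finite (eigen_block n l s)"
  by (simp add: eigen_block_def)

lemma eigendecomposition_apply:
  assumes "eigendecomposition \<rho> n l \<phi>"
  shows "\<rho> *v v = (\<Sum>i<n. (of_real (l i) * cinner (\<phi> i) v) *s \<phi> i)"
proof -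
  have "\<rho> = (\<Sum>i<n. l i *\<^sub>R proj (\<phi> i))"
    using assms unfolding eigendecomposition_def by blast
  then show ?thesis
    by (simp add: matrix_vector_sum scaleR_matrix_vector proj_matrix_vector)
qed

lemma eigendecomposition_orthonormal:
  assumes "eigendecomposition \<rho> n l \<phi>" "i < n" "j < n"
  shows "cinner (\<phi> i) (\<phi> j) = (if i = j then 1 else 0)"
  using assms unfolding eigendecomposition_def by blast

lemma eigendecomposition_norm:
  assumes "eigendecomposition \<rho> n l \<phi>" "i < n"
  shows "norm (\<phi> i) = 1"
  using eigendecomposition_orthonormal[OF assms assms(2)] by (simp add: cinner_self_eq_1)

lemma eigendecomposition_pos:
  assumes "eigendecomposition \<rho> n l \<phi>" "i < n"
  shows "0 < l i"
  using assms unfolding eigendecomposition_def by blast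

lemma eigendecomposition_coefficient:
  assumes "eigendecomposition \<rho> n l \<phi>" "i < n"
  shows "cinner (\<phi> i) (\<rho> *v v) = of_real (l i) * cinner (\<phi> i) v"
proof -
  have "cinner (\<phi> i) (\<rho> *v v) = (\<Sum>j<n. if j = i then of_real (l j) * cinner (\<phi> j) v else 0)"
    unfolding eigendecomposition_apply[OF assms(1)] cinner_sum_right cinner_scale_right
    using eigendecomposition_orthonormal[OF assms(1)] assms(2) by (intro sum.cong) auto
  then show ?thesis
    using assms(2) by simp
qed

lemma eigendecomposition_eigenvector:
  assumes "eigendecomposition \<rho> n l \<phi>" "i < n"
  shows "\<rho> *v \<phi> i = of_real (l i) *s \<phi> i"
proof -
  have "\<rho> *v \<phi> i = (\<Sum>j<n. if j = i then of_real (l j) *s \<phi> j else 0)"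
    unfolding eigendecomposition_apply[OF assms(1)]
    using eigendecomposition_orthonormal[OF assms(1)] assms(2) by (intro sum.cong) auto
  then show ?thesis
    using assms(2) by simp
qed

text \<open>Pairing the eigenvalue equation with \<open>\<phi> i\<close> gives (l i - s) <\<phi> i,
  v> = 0, so only indices with eigenvalue s survive. The family has positive eigenvalues and is
  orthogonal to the kernel of \<rho>, hence s \<noteq> 0.\<close>

lemma eigenspace_expansion:
  assumes eig: "eigendecomposition \<rho> n l \<phi>" and v: "\<rho> *v v = of_real s *s v" and "s \<noteq> 0"
  shows "v = (\<Sum>i\<in>eigen_block n l s. cinner (\<phi> i) v *s \<phi> i)"
proof -
  have "of_real s *s v = (\<Sum>i<n. (of_real (l i) * cinner (\<phi> i) v) *s \<phi> i)"
    using eigendecomposition_apply[OF eig, of v] v by simp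
  also have "\<dots> = (\<Sum>i\<in>eigen_block n l s. (of_real (l i) * cinner (\<phi> i) v) *s \<phi> i)"
  proof (rule sum.mono_neutral_right)
    show "\<forall>i\<in>{..<n} - eigen_block n l s. (of_real (l i) * cinner (\<phi> i) v) *s \<phi> i = 0"
    proof
      fix i assume "i \<in> {..<n} - eigen_block n l s"
      moreover from this have "of_real (l i) * cinner (\<phi> i) v = of_real s * cinner (\<phi> i) v"
        using eigendecomposition_coefficient[OF eig, of i v] v by (auto simp: cinner_scale_right)
      ultimately show "(of_real (l i) * cinner (\<phi> i) v) *s \<phi> i = 0"
        by (cases "l i = s") (auto simp: eigen_block_def)
    qed
  qed (auto simp: eigen_block_def)
  also have "\<dots> = of_real s *s (\<Sum>i\<in>eigen_block n l s. cinner (\<phi> i) v *s \<phi> i)"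
    by (simp add: eigen_block_def vec.scale_sum_right)
  finally show ?thesis
    using \<open>s \<noteq> 0\<close> by (simp only: vec.scale_cancel_left) simp
qed

section \<open>Rotations within blocks of equal eigenvalues\<close>

lemma sum_eigen_blocks: "(\<Sum>i<n. f i) = (\<Sum>s\<in>l ` {..<n}. \<Sum>i\<in>eigen_block n l s. f i)"
  for f :: "nat \<Rightarrow> 'c::comm_monoid_add"
proof -
  have "eigen_block n l s = {i \<in> {..<n}. l i = s}" for s
    by (auto simp: eigen_block_def)
  then show ?thesis
    by (simp add: sum.image_gen[of "{..<n}" f l])
qed

lemma block_unitaryD:
  assumes "block_unitary n l U" "i \<in> eigen_block n l s" "j \<in> eigen_block n l s"
  shows "(\<Sum>k\<in>eigen_block n l s. cnj (U k i) * U k j) = (if i = j then 1 else 0)"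
    and "(\<Sum>k\<in>eigen_block n l s. U i k * cnj (U j k)) = (if i = j then 1 else 0)"
  using assms by (auto simp: block_unitary_def eigen_block_def)

lemma block_unitary_adjoint:
  assumes "block_unitary n l U"
  shows "block_unitary n l (\<lambda>i j. cnj (U j i))"
  using assms unfolding block_unitary_def by (auto simp: mult.commute)

text \<open>On each block, \<Phi> U times the adjoint of U is \<Phi>, by orthonormality of the rows
  of U. Rotations can thus be undone, so the optimality of a rotated family can be tested against
  the original one.\<close>

lemma rotate_eigenvectors_adjoint:
  assumes "block_unitary n l U" "i < n"
  shows "rotate_eigenvectors n l (\<lambda>i j. cnj (U j i)) (rotate_eigenvectors n l U \<phi>) i = \<phi> i"
proof -
  let ?K = "eigen_block n l (l i)"
  have i: "i \<in> ?K"
    using assms by (simp add: eigen_block_def)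
  have "rotate_eigenvectors n l (\<lambda>i j. cnj (U j i)) (rotate_eigenvectors n l U \<phi>) i
      = (\<Sum>j\<in>?K. \<Sum>k\<in>?K. (cnj (U i j) * U k j) *s \<phi> k)"
    unfolding rotate_eigenvectors_def
    by (intro sum.cong refl) (simp add: eigen_block_def vec.scale_sum_right)
  also have "\<dots> = (\<Sum>k\<in>?K. (\<Sum>j\<in>?K. U k j * cnj (U i j)) *s \<phi> k)"
    by (subst sum.swap) (simp add: vec.scale_sum_left mult.commute)
  also have "\<dots> = (\<Sum>k\<in>?K. if k = i then \<phi> k else 0)"
    by (intro sum.cong refl) (simp add: block_unitaryD(2)[OF assms(1) _ i])
  also have "\<dots> = \<phi> i"
    using i by simp
  finally show ?thesis .
qed

text \<open>Orthonormal columns of U keep the vectors of a block orthonormal, and distinct blocks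
  share no index. Orthonormal rows of U preserve the sum of the \<open>proj (\<phi> i)\<close> over
  a block, and the eigenvalue is constant there.\<close>

lemma eigendecomposition_rotate:
  assumes eig: "eigendecomposition \<rho> n l \<phi>" and U: "block_unitary n l U"
  shows "eigendecomposition \<rho> n l (rotate_eigenvectors n l U \<phi>)"
proof -
  let ?K = "eigen_block n l" and ?\<phi> = "rotate_eigenvectors n l U \<phi>"
  have "cinner (?\<phi> i) (?\<phi> j) = (if i = j then 1 else 0)" if "i < n" "j < n" for i j
  proof -
    have K: "k < n" if "k \<in> ?K s" for k s
      using that by (simp add: eigen_block_def)
    have "cinner (?\<phi> i) (?\<phi> j)
        = (\<Sum>k\<in>?K (l i). \<Sum>m\<in>?K (l j). cnj (U k i) * (U m j * cinner (\<phi> k) (\<phi> m)))"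
      by (subst sum.swap) (simp add: rotate_eigenvectors_def cinner_sum_left cinner_sum_right
          cinner_scale_left cinner_scale_right sum_distrib_left mult.left_commute)
    also have "\<dots> = (\<Sum>k\<in>?K (l i). \<Sum>m\<in>?K (l j). if m = k then cnj (U k i) * U m j else 0)"
      by (intro sum.cong refl) (use K in \<open>simp add: eigendecomposition_orthonormal[OF eig]\<close>)
    also have "\<dots> = (\<Sum>k\<in>?K (l i). if k \<in> ?K (l j) then cnj (U k i) * U k j else 0)"
      by simp
    also have "\<dots> = (if i = j then 1 else 0)"
    proof (cases "l i = l j")
      case True
      then show ?thesis
        using block_unitaryD(1)[OF U, of i "l j" j] that by (simp add: eigen_block_def)
    next
      case False
      then show ?thesis
        by (auto simp: eigen_block_def intro!: sum.neutral)
    qed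
    finally show ?thesis .
  qed
  moreover have "(\<Sum>i<n. l i *\<^sub>R proj (?\<phi> i)) = (\<Sum>i<n. l i *\<^sub>R proj (\<phi> i))"
  proof -
    have "(\<Sum>i\<in>?K s. l i *\<^sub>R proj (?\<phi> i)) = (\<Sum>i\<in>?K s. l i *\<^sub>R proj (\<phi> i))" for s
    proof -
      have "(\<Sum>i\<in>?K s. proj (?\<phi> i)) $ p $ q = (\<Sum>i\<in>?K s. proj (\<phi> i)) $ p $ q" for p q
      proof -
        \<comment> \<open>The sum over i is moved innermost, where it becomes an entry of U times
          its adjoint.\<close>
        have "(\<Sum>i\<in>?K s. proj (?\<phi> i)) $ p $ q
            = (\<Sum>i\<in>?K s. \<Sum>j\<in>?K s. \<Sum>k\<in>?K s.
                (U j i * cnj (U k i)) * (\<phi> j $ p * cnj (\<phi> k $ q)))"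
          unfolding sum_component
          by (intro sum.cong refl)
             (simp add: proj_def rotate_eigenvectors_def eigen_block_def sum_product mult_ac)
        also have "\<dots> = (\<Sum>j\<in>?K s. \<Sum>i\<in>?K s. \<Sum>k\<in>?K s.
                (U j i * cnj (U k i)) * (\<phi> j $ p * cnj (\<phi> k $ q)))"
          by (rule sum.swap)
        also have "\<dots> = (\<Sum>j\<in>?K s. \<Sum>k\<in>?K s.
                (\<Sum>i\<in>?K s. U j i * cnj (U k i)) * (\<phi> j $ p * cnj (\<phi> k $ q)))"
          unfolding sum_distrib_right by (rule sum.cong[OF refl], rule sum.swap)
        also have "\<dots> = (\<Sum>j\<in>?K s. \<Sum>k\<in>?K s. if k = j then \<phi> j $ p * cnj (\<phi> k $ q) else 0)"
          by (intro sum.cong refl) (simp add: block_unitaryD(2)[OF U])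
        also have "\<dots> = (\<Sum>i\<in>?K s. proj (\<phi> i)) $ p $ q"
          by (simp add: proj_def)
        finally show ?thesis .
      qed
      then have "(\<Sum>i\<in>?K s. proj (?\<phi> i)) = (\<Sum>i\<in>?K s. proj (\<phi> i))"
        by (simp add: vec_eq_iff)
      then have "(\<Sum>i\<in>?K s. s *\<^sub>R proj (?\<phi> i)) = (\<Sum>i\<in>?K s. s *\<^sub>R proj (\<phi> i))"
        by (simp flip: scaleR_sum_right)
      then show ?thesis
        by (simp add: eigen_block_def)
    qed
    then show ?thesis
      unfolding sum_eigen_blocks[of _ n l] by simp
  qed
  moreover have "n = rank \<rho>" "\<forall>i<n. 0 < l i" "\<rho> = (\<Sum>i<n. l i *\<^sub>R proj (\<phi> i))"
    using eig unfolding eigendecomposition_def by blast+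
  ultimately show ?thesis
    unfolding eigendecomposition_def by metis
qed

text \<open>The unitary is the change-of-basis matrix with entries
  \<open>cinner (\<phi> j) (\<psi> i)\<close>. One unitarity relation is the inner product of two
  \<psi>s expanded in \<phi>, the other that of two \<phi>s expanded in \<psi>. The former expansion
  follows from the eigenvalue equation; the latter is \<open>exp\<close>, which says that the
  \<psi>s fill each eigenspace.\<close>

lemma exists_block_unitary:
  assumes eig: "eigendecomposition \<rho> n l \<phi>"
    and eigen: "\<And>i. i < n \<Longrightarrow> \<rho> *v \<psi> i = of_real (l i) *s \<psi> i"
    and unit: "\<And>i. i < n \<Longrightarrow> norm (\<psi> i) = 1"
    and orth: "\<And>i j. i < n \<Longrightarrow> j < n \<Longrightarrow> l i = l j \<Longrightarrow> i \<noteq> j \<Longrightarrow> cinner (\<psi> i) (\<psi> j) = 0"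
    and exp: "\<And>i. i < n \<Longrightarrow> \<phi> i = (\<Sum>j\<in>eigen_block n l (l i). cinner (\<psi> j) (\<phi> i) *s \<psi> j)"
  obtains U where "block_unitary n l U" "\<And>i. i < n \<Longrightarrow> rotate_eigenvectors n l U \<phi> i = \<psi> i"
proof
  let ?U = "\<lambda>j i. cinner (\<phi> j) (\<psi> i)"
  have exp': "\<psi> i = (\<Sum>j\<in>eigen_block n l (l i). cinner (\<phi> j) (\<psi> i) *s \<phi> j)" if "i < n" for i
    using eigenspace_expansion[OF eig eigen[OF that]] eigendecomposition_pos[OF eig that] by simp
  then show "rotate_eigenvectors n l ?U \<phi> i = \<psi> i" if "i < n" for i
    using that by (simp add: rotate_eigenvectors_def)
  show "block_unitary n l ?U"
    unfolding block_unitary_def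
  proof (intro ballI conjI)
    fix s i j assume "i \<in> eigen_block n l s" "j \<in> eigen_block n l s"
    then have ij: "i < n" "j < n" "l i = s" "l j = s"
      by (auto simp: eigen_block_def)
    have "(\<Sum>k\<in>eigen_block n l s. cnj (?U k i) * ?U k j) = cinner (\<psi> i) (\<psi> j)"
      using cinner_expansion[OF exp'[OF ij(2)], of "\<psi> i"] ij
      by (simp add: cinner_commute[of "\<psi> i" "\<phi> _"])
    then show "(\<Sum>k\<in>eigen_block n l s. cnj (?U k i) * ?U k j) = (if i = j then 1 else 0)"
      using orth unit ij by (simp add: cinner_self)
    have "(\<Sum>k\<in>eigen_block n l s. ?U i k * cnj (?U j k)) = cinner (\<phi> i) (\<phi> j)"
      using cinner_expansion[OF exp[OF ij(2)], of "\<phi> i"] ij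
      by (simp add: cinner_commute[of "\<psi> _" "\<phi> j"])
    then show "(\<Sum>k\<in>eigen_block n l s. ?U i k * cnj (?U j k)) = (if i = j then 1 else 0)"
      using eigendecomposition_orthonormal[OF eig] ij by simp
  qed
qed

text \<open>
  The spectral theorem is not needed here: the \<open>P k\<close> split every eigenspace of \<open>\<rho>\<close>, so a maximal
  orthonormal set of eigenvectors in \<open>G\<close> already spans it.
\<close>

lemma eigenspace_adapted_basis:
  fixes \<rho> :: "complex ^ 'n::finite ^ 'n" and P :: "'k \<Rightarrow> complex ^ 'n ^ 'n"
  assumes herm: "\<And>k. k \<in> I \<Longrightarrow> hconj (P k) = P k"
    and comm: "\<And>k. k \<in> I \<Longrightarrow> \<rho> ** P k = P k ** \<rho>"
    and sum: "(\<Sum>k\<in>I. P k) = mat 1"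
    and scale: "\<And>c g. g \<in> G \<Longrightarrow> c *s g \<in> G"
    and range: "\<And>k v. k \<in> I \<Longrightarrow> P k *v v \<in> G"
    and fixed: "\<And>k g. k \<in> I \<Longrightarrow> g \<in> G \<Longrightarrow> P k *v g = g \<or> P k *v g = 0"
  obtains T where "T \<subseteq> G" "orthonormal T" "finite T" "\<And>t. t \<in> T \<Longrightarrow> \<rho> *v t = s *s t"
    "\<And>v. \<rho> *v v = s *s v \<Longrightarrow> v = (\<Sum>t\<in>T. cinner t v *s t)"
proof -
  define V where "V = {v. \<rho> *v v = s *s v}"
  have V_scale: "c *s v \<in> V" if "v \<in> V" for c v
    using that by (simp add: V_def vec.scale vec.scale_left_commute)
  \<comment> \<open>\<open>V \<inter> G\<close> need not be a subspace, so maximality only excludes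
    a further unit vector of \<open>V \<inter> G\<close> orthogonal to \<open>T\<close>. The
    operators \<open>P k\<close> have to bring arbitrary vectors of \<open>V\<close> into this
    set.\<close>
  obtain T where T: "T \<subseteq> V \<inter> G" "orthonormal T" "finite T"
    and max: "\<And>u. u \<in> V \<inter> G \<Longrightarrow> norm u = 1 \<Longrightarrow> \<exists>t\<in>T. cinner t u \<noteq> 0"
    by (rule maximal_orthonormal_extension[of "{}" "V \<inter> G"]) (auto simp: orthonormal_def)
  have "v = (\<Sum>t\<in>T. cinner t v *s t)" if "v \<in> V" for v
  proof (rule ccontr)
    define w where "w = v - (\<Sum>t\<in>T. cinner t v *s t)"
    assume "v \<noteq> (\<Sum>t\<in>T. cinner t v *s t)"
    then have "w \<noteq> 0"
      by (simp add: w_def)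
    have "\<rho> *v (\<Sum>t\<in>T. cinner t v *s t) = s *s (\<Sum>t\<in>T. cinner t v *s t)"
      unfolding vec.sum vec.scale vec.scale_sum_right
      using T by (intro sum.cong refl) (auto simp: V_def vec.scale_left_commute)
    then have wV: "\<rho> *v w = s *s w"
      using that by (simp add: w_def V_def vec.diff vec.scale_right_diff_distrib)
    \<comment> \<open>The \<open>P k\<close> resolve the identity, so some component
      \<open>P k *v w\<close> is nonzero, and it lies in \<open>G\<close>, which w need not
      do.\<close>
    have "(\<Sum>k\<in>I. P k *v w) = w"
      using sum by (simp flip: matrix_vector_sum)
    with \<open>w \<noteq> 0\<close> obtain k where k: "k \<in> I" "P k *v w \<noteq> 0"
      by (metis sum.neutral)
    then obtain c where c: "norm (c *s (P k *v w)) = 1"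
      by (metis exists_unit_multiple)
    have "\<rho> *v (P k *v w) = P k *v (\<rho> *v w)"
      using comm[OF k(1)] by (simp add: matrix_vector_mul_assoc)
    then have "P k *v w \<in> V"
      by (simp add: V_def wV vec.scale)
    then have "c *s (P k *v w) \<in> V \<inter> G"
      using V_scale scale range k by blast
    then obtain t where t: "t \<in> T" "cinner t (c *s (P k *v w)) \<noteq> 0"
      using max c by blast
    have "cinner t w = 0"
      using cinner_residual T t by (simp add: w_def)
    \<comment> \<open>Moved to the left argument, \<open>P k\<close> fixes t or kills it. Either way
      the product with w is zero, against the choice of t.\<close>
    moreover have "P k *v t = t \<or> P k *v t = 0"
      using fixed k T t by blast
    moreover have "cinner t (P k *v w) = cinner (P k *v t) w"
      using cinner_hconj[of "P k" t w] herm k by simp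
    moreover have "cinner 0 w = 0"
      by (simp add: cinner_def)
    ultimately have "cinner t (P k *v w) = 0"
      by auto
    with t show False
      by (simp add: cinner_scale_right)
  qed
  with T that show ?thesis
    by (auto simp: V_def)
qed

text \<open>Bases of the separate eigenspaces have to become one family indexed like \<phi>. Each is
  a set of the same size as the block of its eigenvalue, so a bijection labels it by the indices of
  that block.\<close>

lemma adapted_block_unitary:
  fixes \<rho> :: "complex ^ 'n::finite ^ 'n" and P :: "'k \<Rightarrow> complex ^ 'n ^ 'n"
  assumes eig: "eigendecomposition \<rho> n l \<phi>"
    and "\<And>k. k \<in> I \<Longrightarrow> hconj (P k) = P k"
    and "\<And>k. k \<in> I \<Longrightarrow> \<rho> ** P k = P k ** \<rho>"
    and "(\<Sum>k\<in>I. P k) = mat 1"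
    and "\<And>c g. g \<in> G \<Longrightarrow> c *s g \<in> G"
    and "\<And>k v. k \<in> I \<Longrightarrow> P k *v v \<in> G"
    and "\<And>k g. k \<in> I \<Longrightarrow> g \<in> G \<Longrightarrow> P k *v g = g \<or> P k *v g = 0"
  obtains U where "block_unitary n l U" "\<And>i. i < n \<Longrightarrow> rotate_eigenvectors n l U \<phi> i \<in> G"
proof -
  let ?K = "eigen_block n l"
  \<comment> \<open>Orthonormality of the image as a set would tolerate repetitions; injectivity
    makes vectors at different indices of a block orthogonal.\<close>
  define good where "good s f \<longleftrightarrow> inj_on f (?K s) \<and> f ` ?K s \<subseteq> G \<and> orthonormal (f ` ?K s) \<and>
      (\<forall>i\<in>?K s. \<rho> *v f i = of_real s *s f i) \<and>
      (\<forall>v. \<rho> *v v = of_real s *s v \<longrightarrow> v = (\<Sum>i\<in>?K s. cinner (f i) v *s f i))"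
    for s and f :: "nat \<Rightarrow> complex ^ 'n"
  have "\<exists>f. good s f" if s: "s \<in> l ` {..<n}" for s
  proof -
    have "s \<noteq> 0"
      using s eigendecomposition_pos[OF eig] by fastforce
    obtain T where T: "T \<subseteq> G" "orthonormal T" "finite T"
      "\<And>t. t \<in> T \<Longrightarrow> \<rho> *v t = of_real s *s t"
      "\<And>v. \<rho> *v v = of_real s *s v \<Longrightarrow> v = (\<Sum>t\<in>T. cinner t v *s t)"
      using eigenspace_adapted_basis[OF assms(2-), where s = "of_real s"] by blast
    have "card (?K s) = card T"
    proof (rule card_eq_of_mutual_expansion)
      fix i assume "i \<in> ?K s"
      then have i: "i < n" "l i = s"
        by (auto simp: eigen_block_def)
      then show "norm (\<phi> i) = 1"
        using eigendecomposition_norm[OF eig] by simp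
      show "\<phi> i = (\<Sum>t\<in>T. cinner t (\<phi> i) *s t)"
        using eigendecomposition_eigenvector[OF eig i(1)] i T(5) by simp
    next
      fix t assume t: "t \<in> T"
      then show "norm t = 1"
        using T(2) by (simp add: orthonormal_def flip: cinner_self_eq_1)
      show "t = (\<Sum>i\<in>?K s. cinner (\<phi> i) t *s \<phi> i)"
        using eigenspace_expansion[OF eig T(4)[OF t] \<open>s \<noteq> 0\<close>] .
    qed
    then obtain f where f: "bij_betw f (?K s) T"
      using T(3) finite_same_card_bij by (metis finite_eigen_block)
    then have "inj_on f (?K s)" "f ` ?K s = T"
      by (auto simp: bij_betw_def)
    moreover have "(\<Sum>i\<in>?K s. cinner (f i) v *s f i) = (\<Sum>t\<in>T. cinner t v *s t)" for v
      using sum.reindex_bij_betw[OF f, of "\<lambda>t. cinner t v *s t"] .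
    ultimately have "good s f"
      unfolding good_def using T by auto
    then show ?thesis
      by blast
  qed
  then obtain f where f: "\<And>s. s \<in> l ` {..<n} \<Longrightarrow> good s (f s)"
    by metis
  \<comment> \<open>The blocks partition the indices, so index i consults the labelling that belongs
    to its own eigenvalue.\<close>
  define \<psi> where "\<psi> i = f (l i) i" for i
  have good: "good (l i) (f (l i))" "i \<in> ?K (l i)" if "i < n" for i
    using f that by (auto simp: eigen_block_def)
  obtain U where U: "block_unitary n l U" "\<And>i. i < n \<Longrightarrow> rotate_eigenvectors n l U \<phi> i = \<psi> i"
  proof (rule exists_block_unitary[OF eig, of \<psi>])
    fix i assume i: "i < n"
    note g = good[OF i]
    show "\<rho> *v \<psi> i = of_real (l i) *s \<psi> i"
      using g by (simp add: good_def \<psi>_def)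
    show "norm (\<psi> i) = 1"
      using g by (simp add: good_def \<psi>_def orthonormal_def flip: cinner_self_eq_1)
    have "\<phi> i = (\<Sum>j\<in>?K (l i). cinner (f (l i) j) (\<phi> i) *s f (l i) j)"
      using g eigendecomposition_eigenvector[OF eig i] by (simp add: good_def)
    also have "\<dots> = (\<Sum>j\<in>?K (l i). cinner (\<psi> j) (\<phi> i) *s \<psi> j)"
      by (intro sum.cong refl) (simp add: eigen_block_def \<psi>_def)
    finally show "\<phi> i = (\<Sum>j\<in>?K (l i). cinner (\<psi> j) (\<phi> i) *s \<psi> j)" .
    fix j assume j: "j < n" "l i = l j" "i \<noteq> j"
    then show "cinner (\<psi> i) (\<psi> j) = 0"
      using g good[OF j(1)] by (auto simp: good_def \<psi>_def orthonormal_def inj_on_def)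
  qed blast
  moreover have "\<psi> i \<in> G" if "i < n" for i
    using good[OF that] by (auto simp: good_def \<psi>_def)
  ultimately show ?thesis
    using that by simp
qed

subsection \<open>Vanishing of the correlation measure\<close>

lemma entanglement_measureD:
  assumes "entanglement_measure E" "norm \<phi> = 1"
  shows "0 \<le> E (proj \<phi>)" "E (proj \<phi>) = 0 \<longleftrightarrow> product_vector \<phi>"
  using assms by (auto simp: entanglement_measure_def)

lemma nonorthogonality_measureD:
  assumes "nonorthogonality_measure F" "density_matrix \<rho>" "density_matrix \<sigma>"
  shows "0 \<le> F \<rho> \<sigma>" "F \<rho> \<sigma> = 0 \<longleftrightarrow> \<rho> = \<sigma> \<or> \<rho> ** \<sigma> = 0"
proof -
  have "if \<rho> = \<sigma> \<or> \<rho> ** \<sigma> = 0 then F \<rho> \<sigma> = 0 else F \<rho> \<sigma> > 0"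
    using assms by (simp add: nonorthogonality_measure_def)
  then show "0 \<le> F \<rho> \<sigma>" "F \<rho> \<sigma> = 0 \<longleftrightarrow> \<rho> = \<sigma> \<or> \<rho> ** \<sigma> = 0"
    by (auto split: if_splits)
qed

lemma average_entanglement_eq_0_iff:
  assumes E: "entanglement_measure E" and unit: "\<And>i. i < n \<Longrightarrow> norm (\<phi> i) = 1"
  shows "0 \<le> average_entanglement E n l \<phi>"
    and "average_entanglement E n l \<phi> = 0 \<longleftrightarrow> (\<forall>i<n. product_vector (\<phi> i))"
proof -
  define g where "g s = 1 / real (card (eigen_block n l s)) *
    (\<Sum>j\<in>eigen_block n l s. E (proj (\<phi> j)))" for s
  have avg: "average_entanglement E n l \<phi> = (\<Sum>s\<in>l ` {..<n}. g s)"
    by (simp add: average_entanglement_def g_def)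
  have nonneg: "0 \<le> E (proj (\<phi> j))" if "j \<in> eigen_block n l s" for j s
    using that entanglement_measureD[OF E unit] by (simp add: eigen_block_def)
  then have g: "0 \<le> g s" for s
    by (simp add: g_def sum_nonneg)
  then show "0 \<le> average_entanglement E n l \<phi>"
    by (simp add: avg sum_nonneg)
  \<comment> \<open>This holds for every real s: on an empty block the weight 1 / 0 is 0 and the
    right-hand side is vacuous.\<close>
  have "g s = 0 \<longleftrightarrow> (\<forall>j\<in>eigen_block n l s. product_vector (\<phi> j))" for s
  proof -
    have "g s = 0 \<longleftrightarrow> (\<forall>j\<in>eigen_block n l s. E (proj (\<phi> j)) = 0)"
      using nonneg by (auto simp: g_def sum_nonneg_eq_0_iff)
    then show ?thesis
      using entanglement_measureD[OF E unit] by (simp add: eigen_block_def)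
  qed
  then have "average_entanglement E n l \<phi> = 0
      \<longleftrightarrow> (\<forall>s\<in>l ` {..<n}. \<forall>j\<in>eigen_block n l s. product_vector (\<phi> j))"
    by (simp add: avg sum_nonneg_eq_0_iff g)
  then show "average_entanglement E n l \<phi> = 0 \<longleftrightarrow> (\<forall>i<n. product_vector (\<phi> i))"
    by (auto simp: eigen_block_def)
qed

lemma average_entanglement_cong:
  assumes "\<And>i. i < n \<Longrightarrow> \<phi> i = \<psi> i"
  shows "average_entanglement E n l \<phi> = average_entanglement E n l \<psi>"
  unfolding average_entanglement_def
  using assms by (intro sum.cong arg_cong2[where f = "(*)"] refl) (auto simp: eigen_block_def)

text \<open>A condition on eigenvectors alone, free of \<open>E\<close>, \<open>F\<close> and
  optimality, with which both the vanishing of a measure and classical correlation are compared.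
  \<open>tr\<close> stands for either partial trace, so that one argument serves both
  subsystems.\<close>

definition product_rotation ::
  "(complex ^ ('a::finite \<times> 'b::finite) ^ ('a \<times> 'b) \<Rightarrow> complex ^ 'c::finite ^ 'c) \<Rightarrow>
     nat \<Rightarrow> (nat \<Rightarrow> real) \<Rightarrow> (nat \<Rightarrow> complex ^ ('a \<times> 'b)) \<Rightarrow> (nat \<Rightarrow> nat \<Rightarrow> complex) \<Rightarrow> bool" where
  "product_rotation tr n l \<phi> U \<longleftrightarrow> block_unitary n l U \<and>
     (\<forall>i<n. product_vector (rotate_eigenvectors n l U \<phi> i)) \<and>
     (\<forall>i<n. \<forall>j<n. let \<sigma> = (\<lambda>k. tr (proj (rotate_eigenvectors n l U \<phi> k)))
        in \<sigma> i = \<sigma> j \<or> \<sigma> i ** \<sigma> j = 0)"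

text \<open>If the value is zero, the minimising rotation itself is a product rotation. Conversely,
  a product rotation has average entanglement 0, the least possible, so it is optimal; its
  nonorthogonality 0 then bounds the minimum from above.\<close>

lemma correlation_measure_eq_0_iff:
  fixes tr :: "complex ^ ('a::finite \<times> 'b::finite) ^ ('a \<times> 'b) \<Rightarrow> complex ^ 'c::finite ^ 'c"
  assumes E: "entanglement_measure E" and F: "nonorthogonality_measure F"
    and tr: "\<And>\<phi>. norm \<phi> = 1 \<Longrightarrow> density_matrix (tr (proj \<phi>))"
    and opt: "optimal_eigendecomposition E \<rho> n l \<phi>"
    and N: "\<And>\<phi>. N \<phi> = (\<Sum>i<n. \<Sum>j<n. l i * l j * F (tr (proj (\<phi> i))) (tr (proj (\<phi> j))))"
    and min: "attains_min (\<lambda>U. N (rotate_eigenvectors n l U \<phi>)) (optimal_unitaries E \<rho> n l \<phi>)"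
  shows "(\<Sum>i<n. l i * E (proj (\<phi> i))) +
      (INF U\<in>optimal_unitaries E \<rho> n l \<phi>. N (rotate_eigenvectors n l U \<phi>)) = 0
    \<longleftrightarrow> (\<exists>U. product_rotation tr n l \<phi> U)"
proof -
  let ?rot = "\<lambda>U. rotate_eigenvectors n l U \<phi>" and ?S = "optimal_unitaries E \<rho> n l \<phi>"
  have eig: "eigendecomposition \<rho> n l \<phi>"
    using opt by (simp add: optimal_eigendecomposition_def)
  note unit = eigendecomposition_norm[OF eig] and pos = eigendecomposition_pos[OF eig]
  note eig_rot = eigendecomposition_rotate[OF eig]
  have N0: "0 \<le> N \<psi>" "N \<psi> = 0 \<longleftrightarrow> (\<forall>i<n. \<forall>j<n. let \<sigma> = (\<lambda>k. tr (proj (\<psi> k)))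
        in \<sigma> i = \<sigma> j \<or> \<sigma> i ** \<sigma> j = 0)" if \<psi>: "\<And>i. i < n \<Longrightarrow> norm (\<psi> i) = 1" for \<psi>
  proof -
    note F' = nonorthogonality_measureD[OF F tr[OF \<psi>] tr[OF \<psi>]]
    have 0: "0 \<le> l i * l j * F (tr (proj (\<psi> i))) (tr (proj (\<psi> j)))" if "i < n" "j < n" for i j
      using F'(1)[OF that] pos[OF that(1)] pos[OF that(2)] by simp
    then show "0 \<le> N \<psi>"
      unfolding N by (intro sum_nonneg) auto
    have "N \<psi> = 0 \<longleftrightarrow> (\<forall>i<n. (\<Sum>j<n. l i * l j * F (tr (proj (\<psi> i))) (tr (proj (\<psi> j)))) = 0)"
      unfolding N using 0 by (subst sum_nonneg_eq_0_iff) (auto intro!: sum_nonneg)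
    also have "\<dots> \<longleftrightarrow> (\<forall>i<n. \<forall>j<n. l i * l j * F (tr (proj (\<psi> i))) (tr (proj (\<psi> j))) = 0)"
    proof -
      have "(\<Sum>j<n. l i * l j * F (tr (proj (\<psi> i))) (tr (proj (\<psi> j)))) = 0
          \<longleftrightarrow> (\<forall>j<n. l i * l j * F (tr (proj (\<psi> i))) (tr (proj (\<psi> j))) = 0)" if "i < n" for i
        using 0 that by (subst sum_nonneg_eq_0_iff) auto
      then show ?thesis
        by blast
    qed
    also have "\<dots> \<longleftrightarrow> (\<forall>i<n. \<forall>j<n. let \<sigma> = (\<lambda>k. tr (proj (\<psi> k)))
        in \<sigma> i = \<sigma> j \<or> \<sigma> i ** \<sigma> j = 0)"
    proof -
      have "l i * l j * F (tr (proj (\<psi> i))) (tr (proj (\<psi> j))) = 0 \<longleftrightarrow>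
          tr (proj (\<psi> i)) = tr (proj (\<psi> j)) \<or> tr (proj (\<psi> i)) ** tr (proj (\<psi> j)) = 0"
        if "i < n" "j < n" for i j
        using F'(2)[OF that] pos[OF that(1)] pos[OF that(2)] by simp
      then show ?thesis
        by (simp add: Let_def)
    qed
    finally show "N \<psi> = 0 \<longleftrightarrow> (\<forall>i<n. \<forall>j<n. let \<sigma> = (\<lambda>k. tr (proj (\<psi> k)))
        in \<sigma> i = \<sigma> j \<or> \<sigma> i ** \<sigma> j = 0)" .
  qed
  have E0: "0 \<le> (\<Sum>i<n. l i * E (proj (\<phi> i)))"
    "(\<Sum>i<n. l i * E (proj (\<phi> i))) = 0 \<longleftrightarrow> (\<forall>i<n. product_vector (\<phi> i))"
  proof -
    have 0: "0 \<le> l i * E (proj (\<phi> i))" if "i < n" for i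
      using entanglement_measureD[OF E unit[OF that]] pos[OF that] by simp
    then show "0 \<le> (\<Sum>i<n. l i * E (proj (\<phi> i)))"
      by (intro sum_nonneg) auto
    have "(\<Sum>i<n. l i * E (proj (\<phi> i))) = 0 \<longleftrightarrow> (\<forall>i<n. l i * E (proj (\<phi> i)) = 0)"
      using 0 by (subst sum_nonneg_eq_0_iff) auto
    moreover have "l i * E (proj (\<phi> i)) = 0 \<longleftrightarrow> product_vector (\<phi> i)" if "i < n" for i
      using entanglement_measureD(2)[OF E unit[OF that]] pos[OF that] by simp
    ultimately show "(\<Sum>i<n. l i * E (proj (\<phi> i))) = 0 \<longleftrightarrow> (\<forall>i<n. product_vector (\<phi> i))"
      by simp
  qed
  have unit_rot: "norm (?rot U i) = 1" if "block_unitary n l U" "i < n" for U i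
    using eigendecomposition_norm[OF eig_rot] that by simp
  have N_rot: "0 \<le> N (?rot U)" "N (?rot U) = 0 \<longleftrightarrow> (\<forall>i<n. \<forall>j<n.
        let \<sigma> = (\<lambda>k. tr (proj (?rot U k))) in \<sigma> i = \<sigma> j \<or> \<sigma> i ** \<sigma> j = 0)"
    if "block_unitary n l U" for U
    using N0[of "?rot U"] unit_rot[OF that] by blast+
  have avg: "0 \<le> average_entanglement E n l \<phi>"
    "average_entanglement E n l \<phi> = 0 \<longleftrightarrow> (\<forall>i<n. product_vector (\<phi> i))"
    using average_entanglement_eq_0_iff[OF E, of n \<phi> l] unit by blast+
  have avg_rot: "0 \<le> average_entanglement E n l (?rot U)"
    "average_entanglement E n l (?rot U) = 0 \<longleftrightarrow> (\<forall>i<n. product_vector (?rot U i))"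
    if "block_unitary n l U" for U
    using average_entanglement_eq_0_iff[OF E, of n "?rot U" l] unit_rot[OF that] by blast+
  obtain U\<^sub>0 where U\<^sub>0: "U\<^sub>0 \<in> ?S" "\<And>U. U \<in> ?S \<Longrightarrow> N (?rot U\<^sub>0) \<le> N (?rot U)"
    using min by (auto simp: attains_min_def)
  \<comment> \<open>Attainment turns the infimum into the value at an actual rotation, which is the
    witness in the forward direction.\<close>
  then have inf: "(INF U\<in>?S. N (?rot U)) = N (?rot U\<^sub>0)"
    by (intro cInf_eq_minimum) auto
  have block\<^sub>0: "block_unitary n l U\<^sub>0" and opt\<^sub>0: "optimal_eigendecomposition E \<rho> n l (?rot U\<^sub>0)"
    using U\<^sub>0 by (auto simp: optimal_unitaries_def)
  show ?thesis
  proof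
    assume "(\<Sum>i<n. l i * E (proj (\<phi> i))) + (INF U\<in>?S. N (?rot U)) = 0"
    with E0(1) N_rot(1)[OF block\<^sub>0]
    have "(\<Sum>i<n. l i * E (proj (\<phi> i))) = 0" and N: "N (?rot U\<^sub>0) = 0"
      unfolding inf by linarith+
    then have "average_entanglement E n l \<phi> = 0"
      using E0 avg by simp
    \<comment> \<open>Rotating back by the adjoint of \<open>U\<^sub>0\<close> recovers \<phi>,
      whose average is 0; optimality of the rotated family forces its own average down to 0.\<close>
    moreover have "average_entanglement E n l (?rot U\<^sub>0) \<le> average_entanglement E n l
        (rotate_eigenvectors n l (\<lambda>i j. cnj (U\<^sub>0 j i)) (?rot U\<^sub>0))"
      using opt\<^sub>0 block_unitary_adjoint[OF block\<^sub>0] by (simp add: optimal_eigendecomposition_def)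
    moreover have "\<dots> = average_entanglement E n l \<phi>"
      by (intro average_entanglement_cong rotate_eigenvectors_adjoint[OF block\<^sub>0])
    ultimately have "\<forall>i<n. product_vector (?rot U\<^sub>0 i)"
      using avg_rot[OF block\<^sub>0] by simp
    then have "product_rotation tr n l \<phi> U\<^sub>0"
      using N N_rot(2)[OF block\<^sub>0] block\<^sub>0 unfolding product_rotation_def by blast
    then show "\<exists>U. product_rotation tr n l \<phi> U"
      by blast
  next
    assume "\<exists>U. product_rotation tr n l \<phi> U"
    then obtain U where U: "product_rotation tr n l \<phi> U"
      by blast
    then have block: "block_unitary n l U" and NU: "N (?rot U) = 0"
      using N_rot(2) unfolding product_rotation_def by blast+
    have avg_U: "average_entanglement E n l (?rot U) = 0"
      using U avg_rot(2)[OF block] unfolding product_rotation_def by blast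
    moreover have "average_entanglement E n l \<phi> \<le> average_entanglement E n l (?rot U)"
      using opt block by (simp add: optimal_eigendecomposition_def)
    ultimately have "average_entanglement E n l \<phi> = 0"
      using avg(1) by simp
    then have "(\<Sum>i<n. l i * E (proj (\<phi> i))) = 0"
      using E0 avg by simp
    \<comment> \<open>Optimality of \<open>?rot U\<close> concerns rotations of an already rotated
      family. A lower bound of 0 for all of them suffices, as \<open>?rot U\<close> has average
      0.\<close>
    moreover have "0 \<le> average_entanglement E n l (rotate_eigenvectors n l V (?rot U))"
      if "block_unitary n l V" for V
      using eigendecomposition_norm[OF eigendecomposition_rotate[OF eig_rot[OF block] that]]
      by (rule average_entanglement_eq_0_iff(1)[OF E])
    then have "U \<in> ?S"
      using block eig_rot avg_U by (simp add: optimal_unitaries_def optimal_eigendecomposition_def)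
    then have "N (?rot U\<^sub>0) = 0"
      using U\<^sub>0(2) NU N_rot(1)[OF block\<^sub>0] by (metis order_antisym)
    ultimately show "(\<Sum>i<n. l i * E (proj (\<phi> i))) + (INF U\<in>?S. N (?rot U)) = 0"
      by (simp add: inf)
  qed
qed

subsection \<open>Classically correlated states\<close>

text \<open>Each unit eigenvector contributes its eigenvalue to the trace of \<rho>. The eigenvalues
  can therefore serve as probabilities in a classically correlated representation.\<close>

lemma sum_eigenvalues:
  assumes "density_matrix \<rho>" "eigendecomposition \<rho> n l \<phi>"
  shows "(\<Sum>i<n. l i) = 1"
proof -
  have "\<rho> = (\<Sum>i<n. l i *\<^sub>R proj (\<phi> i))"
    using assms(2) unfolding eigendecomposition_def by blast
  then have "trace \<rho> = (\<Sum>i<n. of_real (l i))"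
    using eigendecomposition_norm[OF assms(2)]
    by (simp add: trace_sum trace_scaleR trace_proj cinner_self)
  then have "complex_of_real (\<Sum>i<n. l i) = of_real 1"
    using assms(1) by (simp add: density_matrix_def)
  then show ?thesis
    by (simp only: of_real_eq_iff)
qed

text \<open>A projection determines its vector only up to a phase, and two distinct vectors
  differing by a phase cannot both belong to an orthonormal basis. Replacing each \<open>a i\<close>
  by a vector chosen from its projection removes the ambiguity.\<close>

lemma orthonormal_representatives:
  fixes a :: "nat \<Rightarrow> complex ^ 'n::finite"
  assumes unit: "\<And>i. i < n \<Longrightarrow> norm (a i) = 1"
    and "\<And>i j. i < n \<Longrightarrow> j < n \<Longrightarrow> proj (a i) = proj (a j) \<or> proj (a i) ** proj (a j) = 0"
  shows "\<exists>\<psi> B. orthonormal_basis B \<and> (\<forall>i<n. \<psi> i \<in> B \<and> proj (\<psi> i) = proj (a i))"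
proof -
  \<comment> \<open>The choice depends on i only through \<open>proj (a i)\<close>, so distinct
    representatives come from distinct, hence orthogonal, projections.\<close>
  define \<psi> where "\<psi> i = (SOME v. proj v = proj (a i))" for i
  have proj: "proj (\<psi> i) = proj (a i)" for i
    unfolding \<psi>_def by (rule someI) (rule refl)
  then have self: "cinner (\<psi> i) (\<psi> i) = 1" if "i < n" for i
    using unit[OF that] cinner_self_eq_1 trace_proj by metis
  have "cinner (\<psi> i) (\<psi> j) = 0" if "i < n" "j < n" "\<psi> i \<noteq> \<psi> j" for i j
  proof -
    have "proj (a i) \<noteq> proj (a j)"
      using that by (auto simp: \<psi>_def)
    then have "proj (\<psi> i) ** proj (\<psi> j) = 0"
      using assms(2)[OF that(1,2)] by (simp add: proj)
    moreover have "\<psi> i \<noteq> 0" "\<psi> j \<noteq> 0"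
      using self that by fastforce+
    ultimately show ?thesis
      by (simp add: proj_mult_proj_eq_0)
  qed
  then have "orthonormal (\<psi> ` {..<n})"
    using self by (auto simp: orthonormal_def)
  then obtain B where "\<psi> ` {..<n} \<subseteq> B" "orthonormal_basis B"
    by (rule extend_to_orthonormal_basis)
  with proj show ?thesis
    by (intro exI[of _ \<psi>] exI[of _ B]) auto
qed

section \<open>Local projections along an orthonormal basis\<close>

lemma orthonormal_basis_norm:
  assumes "orthonormal_basis B" "u \<in> B"
  shows "norm u = 1"
  using assms by (simp add: orthonormal_basis_def flip: cinner_self_eq_1)

lemma orthonormal_basis_proj:
  assumes "orthonormal_basis B" "u \<in> B" "v \<in> B"
  shows "proj u = proj v \<or> proj u ** proj v = 0"
proof (cases "u = v")
  case False
  then have "cinner u v = 0"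
    using assms by (simp add: orthonormal_basis_def)
  then have "proj u ** proj v = 0"
    unfolding vec_eq_iff proj_mult_proj by simp
  then show ?thesis ..
qed simp

lemma orthonormal_basis_proj_commute:
  assumes "orthonormal_basis B" "u \<in> B" "v \<in> B"
  shows "proj u ** proj v = proj v ** proj u"
  using orthonormal_basis_proj[OF assms] orthonormal_basis_proj[OF assms(1,3,2)]
    proj_mult_proj_eq_0 by metis

lemma commute_weighted_sum:
  fixes M :: "'k \<Rightarrow> complex ^ 'n::finite ^ 'n"
  assumes "\<And>k. k \<in> S \<Longrightarrow> M k ** N = N ** M k"
  shows "(\<Sum>k\<in>S. p k *\<^sub>R M k) ** N = N ** (\<Sum>k\<in>S. p k *\<^sub>R M k)"
proof -
  have "((\<Sum>k\<in>S. p k *\<^sub>R M k) ** N) *v v = (N ** (\<Sum>k\<in>S. p k *\<^sub>R M k)) *v v" for v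
  proof -
    have "((\<Sum>k\<in>S. p k *\<^sub>R M k) ** N) *v v = (\<Sum>k\<in>S. of_real (p k) *s ((M k ** N) *v v))"
      by (simp add: matrix_vector_sum scaleR_matrix_vector flip: matrix_vector_mul_assoc)
    also have "\<dots> = (\<Sum>k\<in>S. of_real (p k) *s ((N ** M k) *v v))"
      using assms by simp
    also have "\<dots> = (N ** (\<Sum>k\<in>S. p k *\<^sub>R M k)) *v v"
      by (simp add: matrix_vector_sum scaleR_matrix_vector vec.sum vec.scale
          flip: matrix_vector_mul_assoc)
    finally show ?thesis .
  qed
  then show ?thesis
    by (simp add: matrix_eq)
qed

text \<open>The right factor is the partial inner product of a with v over the first system. The
  local projection thus sends every vector, entangled or not, to a product vector with first factor
  a.\<close>

lemma tensor_proj_left_apply: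
  "tensor_mat (proj a) (mat 1) *v v = tensor_vec a (\<chi> k. \<Sum>i\<in>UNIV. cnj (a $ i) * v $ (i, k))"
  by (simp add: vec_eq_iff matrix_vector_mult_def tensor_mat_def tensor_vec_def proj_def mat_def
      sum_UNIV_prod sum_distrib_left if_distrib[of "(*) _"] if_distribR mult_ac cong: if_cong)

lemma tensor_proj_right_apply:
  "tensor_mat (mat 1) (proj b) *v v = tensor_vec (\<chi> k. \<Sum>i\<in>UNIV. cnj (b $ i) * v $ (k, i)) b"
proof -
  \<comment> \<open>The Kronecker delta of the identity constrains the index of the first system;
    with the sums exchanged, the inner one collapses.\<close>
  have "(tensor_mat (mat 1) (proj b) *v v) $ (k, m)
      = (\<Sum>j\<in>UNIV. \<Sum>i\<in>UNIV. if i = k then b $ m * cnj (b $ j) * v $ (k, j) else 0)" for k m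
    by (subst sum.swap)
       (auto simp: matrix_vector_mult_def tensor_mat_def proj_def mat_def sum_UNIV_prod
         intro!: sum.cong)
  then show ?thesis
    by (simp add: vec_eq_iff tensor_vec_def sum_distrib_right sum_distrib_left mult_ac)
qed

text \<open>Forward, \<rho> commutes with |a><a| \<otimes> 1 for a in \<open>B\<close>, because the
  first factors of its terms are projections onto members of the same basis. Backward, the
  eigenvalues are the probabilities and the pure states \<open>proj (b i)\<close> the conditional
  states; terms sharing a vector \<open>\<psi> i\<close> are not collected.\<close>

lemma classically_correlated_A_iff:
  fixes \<rho> :: "complex ^ ('a::finite \<times> 'b::finite) ^ ('a \<times> 'b)"
  assumes dens: "density_matrix \<rho>" and eig: "eigendecomposition \<rho> n l \<phi>"
  shows "classically_correlated_A \<rho> \<longleftrightarrow> (\<exists>U. product_rotation ptrace_B n l \<phi> U)"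
proof
  assume "classically_correlated_A \<rho>"
  then obtain m p \<psi> \<sigma> B where B: "orthonormal_basis B" "\<forall>k<m. \<psi> k \<in> B"
    and \<rho>: "\<rho> = (\<Sum>k<(m::nat). p k *\<^sub>R tensor_mat (proj (\<psi> k)) (\<sigma> k))"
    unfolding classically_correlated_A_def by blast
  \<comment> \<open>The second factor is arbitrary, zero included, so \<open>G\<close> absorbs
    scalars and contains every value of the local projections.\<close>
  define G :: "(complex ^ ('a \<times> 'b)) set" where "G = {tensor_vec a b | a b. a \<in> B}"
  let ?P = "\<lambda>a. tensor_mat (proj a) (mat 1)"
  obtain U where U: "block_unitary n l U" and G: "\<And>i. i < n \<Longrightarrow> rotate_eigenvectors n l U \<phi> i \<in> G"
  proof (rule adapted_block_unitary[OF eig, of B ?P G])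
    fix a assume a: "a \<in> B"
    show "hconj (?P a) = ?P a"
      by (simp add: hconj_tensor_mat hconj_proj hconj_mat_1)
    show "\<rho> ** ?P a = ?P a ** \<rho>"
      unfolding \<rho> using B a
      by (intro commute_weighted_sum) (simp add: tensor_mat_mult orthonormal_basis_proj_commute)
    show "?P a *v v \<in> G" for v
      using a by (auto simp: G_def tensor_proj_left_apply)
    \<comment> \<open>A vector c \<otimes> b is fixed when c = a and annihilated when c is another
      member of \<open>B\<close>.\<close>
    show "?P a *v g = g \<or> ?P a *v g = 0" if g: "g \<in> G" for g
    proof -
      obtain c b where g: "g = tensor_vec c b" "c \<in> B"
        using g by (auto simp: G_def)
      then show ?thesis
        using B(1) a by (auto simp: tensor_mat_vec proj_matrix_vector tensor_vec_scale_left
            orthonormal_basis_def)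
    qed
  next
    show "(\<Sum>a\<in>B. ?P a) = mat 1"
      by (simp add: sum_proj_orthonormal_basis[OF B(1)] tensor_mat_mat_1 flip: tensor_mat_sum_left)
    show "c *s g \<in> G" if "g \<in> G" for c g
      using that unfolding G_def by (auto simp flip: tensor_vec_scale_right) blast
  qed blast
  have "\<exists>a\<in>B. ptrace_B (proj (rotate_eigenvectors n l U \<phi> i)) = proj a"
    and "product_vector (rotate_eigenvectors n l U \<phi> i)" if i: "i < n" for i
  proof -
    obtain a b where ab: "rotate_eigenvectors n l U \<phi> i = tensor_vec a b" "a \<in> B"
      using G[OF i] by (auto simp: G_def)
    have "norm (tensor_vec a b) = 1"
      using eigendecomposition_norm[OF eigendecomposition_rotate[OF eig U] i] by (simp add: ab)
    then have "norm b = 1"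
      using orthonormal_basis_norm[OF B(1) ab(2)]
      by (simp add: cinner_tensor flip: cinner_self_eq_1)
    then show "\<exists>a\<in>B. ptrace_B (proj (rotate_eigenvectors n l U \<phi> i)) = proj a"
      using ab by (auto simp: ptrace_B_proj_tensor)
    show "product_vector (rotate_eigenvectors n l U \<phi> i)"
      using ab by (auto simp: product_vector_def)
  qed
  then have "product_rotation ptrace_B n l \<phi> U"
    unfolding product_rotation_def Let_def using U orthonormal_basis_proj[OF B(1)] by metis
  then show "\<exists>U. product_rotation ptrace_B n l \<phi> U"
      by blast
next
  assume "\<exists>U. product_rotation ptrace_B n l \<phi> U"
  then obtain U where U: "product_rotation ptrace_B n l \<phi> U"
    by blast
  define \<phi>' where "\<phi>' = rotate_eigenvectors n l U \<phi>"
  have eig': "eigendecomposition \<rho> n l \<phi>'"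
    using eigendecomposition_rotate[OF eig] U by (simp add: product_rotation_def \<phi>'_def)
  have "\<exists>a b. \<phi>' i = tensor_vec a b \<and> norm a = 1 \<and> norm b = 1" if "i < n" for i
    using U that unit_product_vectorE[OF _ eigendecomposition_norm[OF eig' that]]
    unfolding product_rotation_def \<phi>'_def by metis
  then obtain a b where ab: "\<And>i. i < n \<Longrightarrow> \<phi>' i = tensor_vec (a i) (b i)"
    "\<And>i. i < n \<Longrightarrow> norm (a i) = 1" "\<And>i. i < n \<Longrightarrow> norm (b i) = 1"
    by metis
  \<comment> \<open>The reduced state of a unit product vector is the projection onto its factor, so
    the dichotomy for reduced states is one for the factors \<open>a i\<close>.\<close>
  have rel: "proj (a i) = proj (a j) \<or> proj (a i) ** proj (a j) = 0" if "i < n" "j < n" for i j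
  proof -
    have "ptrace_B (proj (\<phi>' i)) = ptrace_B (proj (\<phi>' j)) \<or>
        ptrace_B (proj (\<phi>' i)) ** ptrace_B (proj (\<phi>' j)) = 0"
      using U that unfolding product_rotation_def Let_def \<phi>'_def by blast
    then show ?thesis
      using that by (simp add: ab ptrace_B_proj_tensor)
  qed
  then obtain \<psi> B where B: "orthonormal_basis B" "\<forall>i<n. \<psi> i \<in> B \<and> proj (\<psi> i) = proj (a i)"
    using orthonormal_representatives[of n a, OF ab(2) rel] by blast
  have "\<rho> = (\<Sum>i<n. l i *\<^sub>R proj (\<phi>' i))"
    using eig' unfolding eigendecomposition_def by blast
  also have "\<dots> = (\<Sum>i<n. l i *\<^sub>R tensor_mat (proj (\<psi> i)) (proj (b i)))"
    by (intro sum.cong refl) (simp add: ab B proj_tensor)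
  finally have \<rho>: "\<rho> = (\<Sum>i<n. l i *\<^sub>R tensor_mat (proj (\<psi> i)) (proj (b i)))" .
  show "classically_correlated_A \<rho>"
    unfolding classically_correlated_A_def
    by (rule exI[of _ n], rule exI[of _ l], rule exI[of _ \<psi>], rule exI[of _ "\<lambda>i. proj (b i)"],
        rule exI[of _ B])
       (intro conjI allI impI sum_eigenvalues[OF dens eig] eigendecomposition_pos[OF eig] B(1)
         B(2)[rule_format, THEN conjunct1]
         density_matrix_proj ab(3) \<rho>)
qed

text \<open>The mirror image, with the projections 1 \<otimes> |a><a|. The letters keep their roles:
  a belongs to the distinguished system, now the second, and b to the other one.\<close>

lemma classically_correlated_B_iff:
  fixes \<rho> :: "complex ^ ('a::finite \<times> 'b::finite) ^ ('a \<times> 'b)"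
  assumes dens: "density_matrix \<rho>" and eig: "eigendecomposition \<rho> n l \<phi>"
  shows "classically_correlated_B \<rho> \<longleftrightarrow> (\<exists>U. product_rotation ptrace_A n l \<phi> U)"
proof
  assume "classically_correlated_B \<rho>"
  then obtain m p \<psi> \<sigma> B where B: "orthonormal_basis B" "\<forall>k<m. \<psi> k \<in> B"
    and \<rho>: "\<rho> = (\<Sum>k<(m::nat). p k *\<^sub>R tensor_mat (\<sigma> k) (proj (\<psi> k)))"
    unfolding classically_correlated_B_def by blast
  define G :: "(complex ^ ('a \<times> 'b)) set" where "G = {tensor_vec b a | a b. a \<in> B}"
  let ?P = "\<lambda>a. tensor_mat (mat 1) (proj a)"
  obtain U where U: "block_unitary n l U" and G: "\<And>i. i < n \<Longrightarrow> rotate_eigenvectors n l U \<phi> i \<in> G"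
  proof (rule adapted_block_unitary[OF eig, of B ?P G])
    fix a assume a: "a \<in> B"
    show "hconj (?P a) = ?P a"
      by (simp add: hconj_tensor_mat hconj_proj hconj_mat_1)
    show "\<rho> ** ?P a = ?P a ** \<rho>"
      unfolding \<rho> using B a
      by (intro commute_weighted_sum) (simp add: tensor_mat_mult orthonormal_basis_proj_commute)
    show "?P a *v v \<in> G" for v
      using a by (auto simp: G_def tensor_proj_right_apply)
    show "?P a *v g = g \<or> ?P a *v g = 0" if g: "g \<in> G" for g
    proof -
      obtain c b where g: "g = tensor_vec b c" "c \<in> B"
        using g by (auto simp: G_def)
      then show ?thesis
        using B(1) a by (auto simp: tensor_mat_vec proj_matrix_vector tensor_vec_scale_right
            orthonormal_basis_def)
    qed
  next
    show "(\<Sum>a\<in>B. ?P a) = mat 1"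
      by (simp add: sum_proj_orthonormal_basis[OF B(1)] tensor_mat_mat_1 flip: tensor_mat_sum_right)
    show "c *s g \<in> G" if "g \<in> G" for c g
      using that unfolding G_def by (auto simp flip: tensor_vec_scale_left) blast
  qed blast
  have "\<exists>a\<in>B. ptrace_A (proj (rotate_eigenvectors n l U \<phi> i)) = proj a"
    and "product_vector (rotate_eigenvectors n l U \<phi> i)" if i: "i < n" for i
  proof -
    obtain a b where ab: "rotate_eigenvectors n l U \<phi> i = tensor_vec b a" "a \<in> B"
      using G[OF i] by (auto simp: G_def)
    have "norm (tensor_vec b a) = 1"
      using eigendecomposition_norm[OF eigendecomposition_rotate[OF eig U] i] by (simp add: ab)
    then have "norm b = 1"
      using orthonormal_basis_norm[OF B(1) ab(2)]
      by (simp add: cinner_tensor flip: cinner_self_eq_1)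
    then show "\<exists>a\<in>B. ptrace_A (proj (rotate_eigenvectors n l U \<phi> i)) = proj a"
      using ab by (auto simp: ptrace_A_proj_tensor)
    show "product_vector (rotate_eigenvectors n l U \<phi> i)"
      using ab by (auto simp: product_vector_def)
  qed
  then have "product_rotation ptrace_A n l \<phi> U"
    unfolding product_rotation_def Let_def using U orthonormal_basis_proj[OF B(1)] by metis
  then show "\<exists>U. product_rotation ptrace_A n l \<phi> U"
      by blast
next
  assume "\<exists>U. product_rotation ptrace_A n l \<phi> U"
  then obtain U where U: "product_rotation ptrace_A n l \<phi> U"
    by blast
  define \<phi>' where "\<phi>' = rotate_eigenvectors n l U \<phi>"
  have eig': "eigendecomposition \<rho> n l \<phi>'"
    using eigendecomposition_rotate[OF eig] U by (simp add: product_rotation_def \<phi>'_def)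
  have "\<exists>a b. \<phi>' i = tensor_vec b a \<and> norm a = 1 \<and> norm b = 1" if "i < n" for i
    using U that unit_product_vectorE[OF _ eigendecomposition_norm[OF eig' that]]
    unfolding product_rotation_def \<phi>'_def by metis
  then obtain a b where ab: "\<And>i. i < n \<Longrightarrow> \<phi>' i = tensor_vec (b i) (a i)"
    "\<And>i. i < n \<Longrightarrow> norm (a i) = 1" "\<And>i. i < n \<Longrightarrow> norm (b i) = 1"
    by metis
  have rel: "proj (a i) = proj (a j) \<or> proj (a i) ** proj (a j) = 0" if "i < n" "j < n" for i j
  proof -
    have "ptrace_A (proj (\<phi>' i)) = ptrace_A (proj (\<phi>' j)) \<or>
        ptrace_A (proj (\<phi>' i)) ** ptrace_A (proj (\<phi>' j)) = 0"
      using U that unfolding product_rotation_def Let_def \<phi>'_def by blast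
    then show ?thesis
      using that by (simp add: ab ptrace_A_proj_tensor)
  qed
  then obtain \<psi> B where B: "orthonormal_basis B" "\<forall>i<n. \<psi> i \<in> B \<and> proj (\<psi> i) = proj (a i)"
    using orthonormal_representatives[of n a, OF ab(2) rel] by blast
  have "\<rho> = (\<Sum>i<n. l i *\<^sub>R proj (\<phi>' i))"
    using eig' unfolding eigendecomposition_def by blast
  also have "\<dots> = (\<Sum>i<n. l i *\<^sub>R tensor_mat (proj (b i)) (proj (\<psi> i)))"
    by (intro sum.cong refl) (simp add: ab B proj_tensor)
  finally have \<rho>: "\<rho> = (\<Sum>i<n. l i *\<^sub>R tensor_mat (proj (b i)) (proj (\<psi> i)))" .
  show "classically_correlated_B \<rho>"
    unfolding classically_correlated_B_def
    by (rule exI[of _ n], rule exI[of _ l], rule exI[of _ \<psi>], rule exI[of _ "\<lambda>i. proj (b i)"],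
        rule exI[of _ B])
       (intro conjI allI impI sum_eigenvalues[OF dens eig] eigendecomposition_pos[OF eig] B(1)
         B(2)[rule_format, THEN conjunct1]
         density_matrix_proj ab(3) \<rho>)
qed

theorem theorem2:
  fixes \<rho> :: "complex ^ ('a::finite \<times> 'b::finite) ^ ('a \<times> 'b)"
    and E :: "complex ^ ('a \<times> 'b) ^ ('a \<times> 'b) \<Rightarrow> real"
    and F\<^sub>A :: "complex ^ 'a ^ 'a \<Rightarrow> complex ^ 'a ^ 'a \<Rightarrow> real"
    and F\<^sub>B :: "complex ^ 'b ^ 'b \<Rightarrow> complex ^ 'b ^ 'b \<Rightarrow> real"
    and n :: nat
    and l :: "nat \<Rightarrow> real"
    and \<phi> :: "nat \<Rightarrow> complex ^ ('a \<times> 'b)"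
  assumes "entanglement_measure E"
    and "nonorthogonality_measure F\<^sub>A"
    and "nonorthogonality_measure F\<^sub>B"
    and "density_matrix \<rho>"
    and "optimal_eigendecomposition E \<rho> n l \<phi>"
    and "attains_min (\<lambda>U. nonorthogonality_A F\<^sub>A n l (rotate_eigenvectors n l U \<phi>))
           (optimal_unitaries E \<rho> n l \<phi>)"
    and "attains_min (\<lambda>U. nonorthogonality_B F\<^sub>B n l (rotate_eigenvectors n l U \<phi>))
           (optimal_unitaries E \<rho> n l \<phi>)"
  shows "(Q_QC E F\<^sub>A \<rho> n l \<phi> = 0 \<longleftrightarrow> classically_correlated_A \<rho>) \<and>
         (Q_CQ E F\<^sub>B \<rho> n l \<phi> = 0 \<longleftrightarrow> classically_correlated_B \<rho>)"
proof -
  have eig: "eigendecomposition \<rho> n l \<phi>"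
    using assms(5) by (simp add: optimal_eigendecomposition_def)
  \<comment> \<open>The letters cross: tracing out the second factor leaves the state of the first,
    so the measure subject to A goes with \<open>ptrace_B\<close>.\<close>
  have "Q_QC E F\<^sub>A \<rho> n l \<phi> = 0 \<longleftrightarrow> (\<exists>U. product_rotation ptrace_B n l \<phi> U)"
    unfolding Q_QC_def
    by (rule correlation_measure_eq_0_iff[where F = F\<^sub>A and tr = ptrace_B
          and N = "nonorthogonality_A F\<^sub>A n l"])
       (use assms in \<open>simp_all add: density_matrix_ptrace_B nonorthogonality_A_def\<close>)
  moreover have "Q_CQ E F\<^sub>B \<rho> n l \<phi> = 0 \<longleftrightarrow> (\<exists>U. product_rotation ptrace_A n l \<phi> U)"
    unfolding Q_CQ_def
    by (rule correlation_measure_eq_0_iff[where F = F\<^sub>B and tr = ptrace_A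
          and N = "nonorthogonality_B F\<^sub>B n l"])
       (use assms in \<open>simp_all add: density_matrix_ptrace_A nonorthogonality_B_def\<close>)
  ultimately show ?thesis
    using classically_correlated_A_iff[OF assms(4) eig]
      classically_correlated_B_iff[OF assms(4) eig] by simp
qed

end
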